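(* Let $f=\sum_{n\ge1}a_nq^n$ be a normalized Hecke eigen-cuspform of weight $2$ and level $N$, with $p$ an odd prime such that $p\nmid N$ and $v_p(a_p)>\frac1p$. The following equations hold \begin{align*} \mathcal{L}_{\alpha\beta}^{\mathrm{cyc}}+\mathcal{L}_{\beta\alpha}^{\mathrm{cyc}}&=\mathcal{L}_{\alpha}\mathscr{L}_\beta+\mathcal{L}_{\beta}\mathscr{L}_{\alpha},\\ \mathcal{L}_{\sharp\flat}^{\mathrm{cyc}}+\mathcal{L}_{\flat\sharp}^{\mathrm{cyc}}&=\mathcal{L}_{\sharp}\mathscr{L}_\flat+\mathcal{L}_{\flat}\mathscr{L}_{\sharp}. \end{align*}
   Context: Setting: $p$ is an odd prime; $f$ has nebentype $\epsilon$; $F$ is a finite extension of $\mathbb{Q}_p$ containing all $a_n$, with ring of integers $\mathcal{O}$; $v_p(p)=1$; $\alpha,\beta\in F$ are the roots of $X^2-a_pX+\epsilon(p)p$. $\Gamma$ is the Galois group of the cyclotomic $\mathbb{Z}_p$-extension of $\mathbb{Q}$; $\mathcal{H}$ is the ring of power series in $F[[X]]$ converging on the open unit disk, identified with $F$-valued distributions on $\Gamma$ ($1+X$ a topological generator). With $C=\begin{bmatrix}a_p&1\\-\epsilon(p)p&0\end{bmatrix}$, $A=\begin{bmatrix}-1&-1\\\beta&\alpha\end{bmatrix}$, $C_n=\begin{bmatrix}a_p&1\\-\epsilon(p)\Phi_n&0\end{bmatrix}$ ($\Phi_n$ the $p^n$-th cyclotomic polynomial in $1+X$), $M_{\log}=\lim_{n\to\infty}C_1\cdots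 C_nC^{-n-2}A$. $\mathcal{L}_\alpha,\mathcal{L}_\beta$ are the one-variable $p$-adic $L$-functions of $f$ (Amice–Vélu, Vishik), and $\mathcal{L}_\sharp,\mathcal{L}_\flat\in\mathcal{O}[[\Gamma]]$ satisfy $[\mathcal{L}_\alpha\ \mathcal{L}_\beta]=[\mathcal{L}_\sharp\ \mathcal{L}_\flat]M_{\log}$; $\mathscr{L}_\alpha,\mathscr{L}_\beta,\mathscr{L}_\sharp,\mathscr{L}_\flat$ are the analogues for $f^{(K)}=\sum_na_n\epsilon_K(n)q^n$, $K$ an imaginary quadratic field where $p=\mathfrak{p}\mathfrak{q}$ splits and $\epsilon_K$ its quadratic character. $G$ is the Galois group of the $\mathbb{Z}_p^2$-extension of $K$; $\Gamma_\mathfrak{r}$ ($\mathfrak{r}\in\{\mathfrak{p},\mathfrak{q}\}$) is the Galois group of the $\mathbb{Z}_p$-extension of $K$ unramified at $\overline{\mathfrak{r}}$, with generator $\gamma_\mathfrak{r}\mapsto 1+X$ under $G\to\Gamma$, and $M_{\log,\mathfrak{r}}$ is $M_{\log}$ with $X$ replaced by $\gamma_\mathfrak{r}-1$. Loeffler's two-variable $p$-adic $L$-functions $\mathcal{L}_{\lambda\mu}$ satisfy $\begin{bmatrix}\mathcal{L}_{\alpha\alpha}&\mathcal{L}_{\alpha\beta}\\\mathcal{L}_{\beta\alpha}&\mathcal{L}_{\beta\beta}\end{bmatrix}=M_{\log,\mathfrak{p}}^T\begin{bmatrix}\mathcal{L}_{\sharp\sharp}&\mathcal{L}_{\sharp\flat}\\\mathcal{L}_{\flat\sharp}&\mathcal{L}_{\flat\flat}\end{bmatrix}M_{\log,\mathfrak{q}}$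 with $\mathcal{L}_{\bullet\star}\in\mathcal{O}[[G]]$; superscript $\mathrm{cyc}$ denotes image under $G\to\Gamma$. Periods are chosen so that $\mathcal{L}_{\lambda\lambda}^{\mathrm{cyc}}=\mathcal{L}_\lambda\mathscr{L}_\lambda$ for $\lambda\in\{\alpha,\beta\}$. *)

theory Defs
  imports
    "HOL-Analysis.Analysis"
    "HOL-Computational_Algebra.Computational_Algebra"
    "HOL-Algebra.Algebra"
    "HOL-Algebra.Algebraic_Closure_Type"
begin

hide_const (open) Divisibility.prime

section \<open>The p-adic side\<close>

text \<open>
  The type \<open>'c\<close> plays the role of \<open>\<complex>\<^sub>p\<close>: it is algebraically closed and complete (type classes), its
  metric is the p-adic one, and the elements algebraic over \<open>\<rat>\<^sub>p\<close>, the closure of the rationals,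
  are dense. All p-adic fields below are subfields of it.
\<close>

definition absp :: "'c::{zero,metric_space} \<Rightarrow> real" where
  "absp x = dist x 0"

definition Qp :: "'c::{field_char_0,metric_space} set" where
  "Qp = closure \<rat>"

definition padic_complex_numbers ::
    "nat \<Rightarrow> 'c::{alg_closed_field,field_char_0,complete_space} itself \<Rightarrow> bool" where
  "padic_complex_numbers p _ \<longleftrightarrow>
     (\<forall>x y::'c. dist x y = absp (x - y)) \<and>
     (\<forall>x y::'c. absp (x * y) = absp x * absp y) \<and>
     (\<forall>x y::'c. absp (x + y) \<le> max (absp x) (absp y)) \<and>
     absp (of_nat p :: 'c) = 1 / real p \<and>
     closure {x::'c. \<exists>q. q \<noteq> 0 \<and> (\<forall>i. Polynomial.coeff q i \<in> Qp) \<and> poly q x = 0} = UNIV"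

definition vp :: "nat \<Rightarrow> 'c::{zero,metric_space} \<Rightarrow> ereal" where
  "vp p x = (if x = 0 then \<infinity> else ereal (- log (real p) (absp x)))"

definition finite_extension_Qp :: "'c::{field_char_0,metric_space} set \<Rightarrow> bool" where
  "finite_extension_Qp F \<longleftrightarrow>
     subfield F ring_of_type_algebra \<and> Qp \<subseteq> F \<and>
     ring.finite_dimension ring_of_type_algebra Qp F"

definition valuation_ring :: "'c::{zero,metric_space} set \<Rightarrow> 'c set" where
  "valuation_ring F = {x \<in> F. absp x \<le> 1}"

text \<open>An embedding of the algebraic numbers; its values at transcendental numbers are irrelevant.\<close>

definition embedding_Qbar :: "(complex \<Rightarrow> 'c::field) \<Rightarrow> bool" where
  "embedding_Qbar \<iota> \<longleftrightarrow> \<iota> 1 = 1 \<and>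
     (\<forall>x y. algebraic x \<and> algebraic y \<longrightarrow> \<iota> (x + y) = \<iota> x + \<iota> y \<and> \<iota> (x * y) = \<iota> x * \<iota> y)"


section \<open>Power series and distributions\<close>

text \<open>
  \<open>\<Gamma>\<close>: distributions are power series in \<open>X = \<gamma> - 1\<close>.
  \<open>G = \<Gamma>\<^sub>\<pp> \<times> \<Gamma>\<^sub>\<qq>\<close>: they are series in \<open>\<gamma>\<^sub>\<pp> - 1\<close> (outer variable) and \<open>\<gamma>\<^sub>\<qq> - 1\<close> (inner variable).
  The bounds on the coefficients are Amice's description of distributions of order \<open>h\<close>,
  respectively \<open>(h1, h2)\<close>; for these the series converge on the open unit (poly)disc.
\<close>

definition coeffs_in :: "'c set \<Rightarrow> 'c fps \<Rightarrow> bool" where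
  "coeffs_in S L \<longleftrightarrow> (\<forall>n. fps_nth L n \<in> S)"

definition coeffs_in2 :: "'c set \<Rightarrow> 'c::zero fps fps \<Rightarrow> bool" where
  "coeffs_in2 S L \<longleftrightarrow> (\<forall>i j. fps_nth (fps_nth L i) j \<in> S)"

definition has_order :: "real \<Rightarrow> 'c::{zero,metric_space} fps \<Rightarrow> bool" where
  "has_order h L \<longleftrightarrow> (\<exists>B. \<forall>n. absp (fps_nth L n) \<le> B * (real n + 1) powr h)"

definition has_order2 :: "real \<Rightarrow> real \<Rightarrow> 'c::{zero,metric_space} fps fps \<Rightarrow> bool" where
  "has_order2 h1 h2 L \<longleftrightarrow>
     (\<exists>B. \<forall>i j. absp (fps_nth (fps_nth L i) j) \<le> B * (real i + 1) powr h1 * (real j + 1) powr h2)"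

definition eval1 :: "'c::{field,metric_space} fps \<Rightarrow> 'c \<Rightarrow> 'c" where
  "eval1 L x = suminf (\<lambda>n. fps_nth L n * x ^ n)"

definition eval2 :: "'c::{field,metric_space} fps fps \<Rightarrow> 'c \<Rightarrow> 'c \<Rightarrow> 'c" where
  "eval2 L x y = suminf (\<lambda>i. suminf (\<lambda>j. fps_nth (fps_nth L i) j * y ^ j) * x ^ i)"

definition in_p_variable :: "'c::zero fps \<Rightarrow> 'c fps fps" where
  "in_p_variable L = Abs_fps (\<lambda>i. fps_const (fps_nth L i))"

definition in_q_variable :: "'c::zero fps \<Rightarrow> 'c fps fps" where
  "in_q_variable L = fps_const L"

text \<open>The map induced by \<open>G \<rightarrow> \<Gamma>\<close>: both variables are specialised to \<open>X\<close>.\<close>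

definition cyc :: "'c::comm_monoid_add fps fps \<Rightarrow> 'c fps" where
  "cyc L = Abs_fps (\<lambda>n. \<Sum>i\<le>n. fps_nth (fps_nth L i) (n - i))"

lemma cyc_in_p_variable: "cyc (in_p_variable L) = L"
proof (rule fps_ext)
  fix n
  have "fps_nth (cyc (in_p_variable L)) n = (\<Sum>i\<le>n. if i = n then fps_nth L n else 0)"
    by (auto simp: cyc_def in_p_variable_def intro!: sum.cong)
  then show "fps_nth (cyc (in_p_variable L)) n = fps_nth L n" by simp
qed

lemma cyc_in_q_variable: "cyc (in_q_variable L) = L"
proof (rule fps_ext)
  fix n
  have "fps_nth (cyc (in_q_variable L)) n = (\<Sum>i\<le>n. if i = 0 then fps_nth L n else 0)"
    unfolding cyc_def fps_nth_Abs_fps by (rule sum.cong) (simp_all add: in_q_variable_def)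
  then show "fps_nth (cyc (in_q_variable L)) n = fps_nth L n" by simp
qed


section \<open>The logarithm matrix\<close>

definition Phi :: "nat \<Rightarrow> nat \<Rightarrow> 'c::field_char_0 fps" where
  "Phi p n = (\<Sum>i<p. (1 + fps_X) ^ (i * p ^ (n - 1)))"

lemma Phi_times:
  assumes "n \<ge> 1"
  shows "Phi p n * ((1 + fps_X) ^ (p ^ (n - 1)) - 1) = ((1 + fps_X) ^ (p ^ n) - 1 :: 'c::field_char_0 fps)"
proof -
  define y :: "'c fps" where "y = (1 + fps_X) ^ (p ^ (n - 1))"
  have "Phi p n = (\<Sum>i<p. y ^ i)"
    unfolding Phi_def y_def by (simp add: power_mult [symmetric] mult.commute)
  moreover have "(y - 1) * (\<Sum>i<p. y ^ i) = y ^ p - 1"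
    by (rule power_diff_1_eq [symmetric])
  moreover have "y ^ p = (1 + fps_X) ^ (p ^ n)"
    using assms unfolding y_def by (cases n) (simp_all add: power_mult [symmetric] mult.commute)
  ultimately show ?thesis by (simp add: y_def mult.commute)
qed

definition mat2 :: "'a::zero \<Rightarrow> 'a \<Rightarrow> 'a \<Rightarrow> 'a \<Rightarrow> 'a^2^2" where
  "mat2 a b c d = vector [vector [a, b], vector [c, d]]"

definition mat_pow :: "'a::semiring_1^2^2 \<Rightarrow> nat \<Rightarrow> 'a^2^2" where
  "mat_pow M n = (((**) M) ^^ n) (mat 1)"

text \<open>Here \<open>ap\<close> and \<open>e\<close> stand for the images of \<open>a\<^sub>p\<close> and \<open>\<epsilon>(p)\<close>.\<close>

definition matC :: "nat \<Rightarrow> 'c \<Rightarrow> 'c \<Rightarrow> ('c::field_char_0 fps)^2^2" where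
  "matC p ap e = mat2 (fps_const ap) 1 (fps_const (- e * of_nat p)) 0"

definition matCn :: "nat \<Rightarrow> 'c \<Rightarrow> 'c \<Rightarrow> nat \<Rightarrow> ('c::field_char_0 fps)^2^2" where
  "matCn p ap e n = mat2 (fps_const ap) 1 (- fps_const e * Phi p n) 0"

definition matA :: "'c \<Rightarrow> 'c \<Rightarrow> ('c::field_char_0 fps)^2^2" where
  "matA \<alpha> \<beta> = mat2 (-1) (-1) (fps_const \<beta>) (fps_const \<alpha>)"

fun prodC :: "nat \<Rightarrow> 'c \<Rightarrow> 'c \<Rightarrow> nat \<Rightarrow> ('c::field_char_0 fps)^2^2" where
  "prodC p ap e 0 = mat 1"
| "prodC p ap e (Suc n) = prodC p ap e n ** matCn p ap e (Suc n)"

definition Mlog_approx :: "nat \<Rightarrow> 'c \<Rightarrow> 'c \<Rightarrow> 'c \<Rightarrow> 'c \<Rightarrow> nat \<Rightarrow> ('c::field_char_0 fps)^2^2" where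
  "Mlog_approx p ap e \<alpha> \<beta> n =
     prodC p ap e n ** mat_pow (matrix_inv (matC p ap e)) (n + 2) ** matA \<alpha> \<beta>"

text \<open>
  The limit is taken coefficientwise for the p-adic metric. This is not the limit for the
  \<open>X\<close>-adic metric that the library puts on formal power series; a limit in the Frechet
  topology of the ring of series converging on the open disc is computed coefficientwise.
\<close>

definition Mlog :: "nat \<Rightarrow> 'c \<Rightarrow> 'c \<Rightarrow> 'c \<Rightarrow> 'c \<Rightarrow> ('c::{field_char_0,metric_space} fps)^2^2" where
  "Mlog p ap e \<alpha> \<beta> =
     (\<chi> i j. Abs_fps (\<lambda>k. lim (\<lambda>n. fps_nth (Mlog_approx p ap e \<alpha> \<beta> n $ i $ j) k)))"


section \<open>Number fields, Galois groups and Frobenius elements\<close>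

text \<open>All algebraic extensions of \<open>\<rat>\<close> are subfields of \<open>\<complex>\<close>.\<close>

abbreviation ring_on :: "'a::ring_1 set \<Rightarrow> 'a ring" where
  "ring_on S \<equiv> ring_of_type_algebra\<lparr>carrier := S\<rparr>"

definition integers_of :: "complex set \<Rightarrow> complex set" where
  "integers_of L = {x \<in> L. algebraic_int x}"

definition primes_of :: "complex set \<Rightarrow> complex set set" where
  "primes_of L = {v. primeideal v (ring_on (integers_of L)) \<and> v \<noteq> {0}}"

definition ideal_norm :: "complex set \<Rightarrow> complex set \<Rightarrow> nat" where
  "ideal_norm k v = card (carrier (ring_on (integers_of k) Quot v))"

definition principal_ideal :: "complex set \<Rightarrow> complex \<Rightarrow> complex set" where
  "principal_ideal k x = PIdl\<^bsub>ring_on (integers_of k)\<^esub> x"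

definition ideal_mult :: "complex set \<Rightarrow> complex set \<Rightarrow> complex set \<Rightarrow> complex set" where
  "ideal_mult k I J = ideal_prod (ring_on (integers_of k)) I J"

definition ideal_power :: "complex set \<Rightarrow> complex set \<Rightarrow> nat \<Rightarrow> complex set" where
  "ideal_power k v n = ((ideal_mult k v) ^^ n) (integers_of k)"

definition ideal_ord :: "complex set \<Rightarrow> complex set \<Rightarrow> complex set \<Rightarrow> nat" where
  "ideal_ord k v I = (GREATEST n. I \<subseteq> ideal_power k v n)"

definition residue_char :: "complex set \<Rightarrow> nat" where
  "residue_char v = (THE l. prime l \<and> of_nat l \<in> v)"

definition imaginary_quadratic :: "complex set \<Rightarrow> bool" where
  "imaginary_quadratic K \<longleftrightarrow>
     (\<exists>d::nat. d > 0 \<and> K = {x + y * csqrt (- of_nat d) | x y. x \<in> \<rat> \<and> y \<in> \<rat>})"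

definition splits_as :: "nat \<Rightarrow> complex set \<Rightarrow> complex set \<Rightarrow> complex set \<Rightarrow> bool" where
  "splits_as p K \<pp> \<qq> \<longleftrightarrow> \<pp> \<in> primes_of K \<and> \<qq> \<in> primes_of K \<and> \<pp> \<noteq> \<qq> \<and>
     principal_ideal K (of_nat p) = ideal_mult K \<pp> \<qq>"

definition quadratic_char_at_prime :: "complex set \<Rightarrow> nat \<Rightarrow> complex" where
  "quadratic_char_at_prime K l =
     (if principal_ideal K (of_nat l) \<in> primes_of K then -1
      else if \<exists>v \<in> primes_of K. principal_ideal K (of_nat l) = ideal_mult K v v then 0
      else 1)"

definition quadratic_char :: "complex set \<Rightarrow> nat \<Rightarrow> complex" where
  "quadratic_char K n =
     (if n = 0 then 0 else \<Prod>l\<in>#prime_factorization n. quadratic_char_at_prime K l)"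

definition gal :: "complex set \<Rightarrow> complex set \<Rightarrow> (complex \<Rightarrow> complex) monoid" where
  "gal k L = \<lparr>carrier = {\<sigma> \<in> ring_iso (ring_on L) (ring_on L). \<sigma> \<in> extensional L \<and> (\<forall>x\<in>k. \<sigma> x = x)},
              monoid.mult = compose L, one = (\<lambda>x\<in>L. x)\<rparr>"

text \<open>
  \<open>L/k\<close> is the union of finite Galois extensions \<open>M n\<close> of \<open>k\<close> with groups \<open>(\<int>/p\<^sup>n)\<^sup>d\<close>,
  that is, Galois with group \<open>\<int>\<^sub>p\<^sup>d\<close>.
\<close>

definition Zp_extension :: "nat \<Rightarrow> nat \<Rightarrow> complex set \<Rightarrow> complex set \<Rightarrow> bool" where
  "Zp_extension p d k L \<longleftrightarrow>
     (\<exists>M :: nat \<Rightarrow> complex set. mono M \<and> L = (\<Union>n. M n) \<and>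
        (\<forall>n. subfield (M n) ring_of_type_algebra \<and> k \<subseteq> M n \<and>
             {x \<in> M n. \<forall>\<sigma> \<in> carrier (gal k (M n)). \<sigma> x = x} = k \<and>
             gal k (M n) \<cong> product_group {..<d} (\<lambda>_. integer_mod_group (p ^ n))))"

definition cyclotomic_Zp_extension :: "nat \<Rightarrow> complex set \<Rightarrow> bool" where
  "cyclotomic_Zp_extension p L \<longleftrightarrow> Zp_extension p 1 \<rat> L \<and>
     (\<forall>x\<in>L. \<exists>n c. x = (\<Sum>i<p ^ n. of_rat (c i) * cis (2 * pi * real i / real (p ^ n))))"

definition topologically_generates ::
    "complex set \<Rightarrow> complex set \<Rightarrow> (complex \<Rightarrow> complex) set \<Rightarrow> bool" where
  "topologically_generates k L S \<longleftrightarrow> S \<subseteq> carrier (gal k L) \<and>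
     (\<forall>\<sigma> \<in> carrier (gal k L). \<forall>T. finite T \<and> T \<subseteq> L \<longrightarrow>
        (\<exists>\<tau> \<in> generate (gal k L) S. \<forall>x\<in>T. \<tau> x = \<sigma> x))"

text \<open>
  For abelian \<open>L/k\<close> neither set depends on the prime \<open>w\<close> above \<open>v\<close>; the second one is a coset of
  the first, consisting of arithmetic Frobenius elements.
\<close>

definition inertia :: "complex set \<Rightarrow> complex set \<Rightarrow> complex set \<Rightarrow> (complex \<Rightarrow> complex) set" where
  "inertia k L v = {\<sigma> \<in> carrier (gal k L).
     \<exists>w \<in> primes_of L. v \<subseteq> w \<and> (\<forall>x \<in> integers_of L. \<sigma> x - x \<in> w)}"

definition frobenius :: "complex set \<Rightarrow> complex set \<Rightarrow> complex set \<Rightarrow> (complex \<Rightarrow> complex) set" where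
  "frobenius k L v = {\<sigma> \<in> carrier (gal k L).
     \<exists>w \<in> primes_of L. v \<subseteq> w \<and> (\<forall>x \<in> integers_of L. \<sigma> x - x ^ ideal_norm k v \<in> w)}"

definition unramified_at :: "complex set \<Rightarrow> complex set \<Rightarrow> complex set \<Rightarrow> bool" where
  "unramified_at k L v \<longleftrightarrow> (\<forall>\<sigma> \<in> inertia k L v. \<forall>x\<in>L. \<sigma> x = x)"


section \<open>Finite-order characters, Gauss sums and L-values\<close>

definition finite_order_char :: "complex set \<Rightarrow> complex set \<Rightarrow> ((complex \<Rightarrow> complex) \<Rightarrow> complex) \<Rightarrow> bool" where
  "finite_order_char k L \<omega> \<longleftrightarrow>
     \<omega> \<in> hom (gal k L) (units_of ring_of_type_algebra) \<and>
     (\<exists>T. finite T \<and> T \<subseteq> L \<and> (\<forall>\<sigma> \<in> carrier (gal k L). (\<forall>x\<in>T. \<sigma> x = x) \<longrightarrow> \<omega> \<sigma> = 1))"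

text \<open>The primitive Hecke character attached to \<open>\<omega>\<close>, on prime ideals and on integral ideals.\<close>

definition hecke_at :: "complex set \<Rightarrow> complex set \<Rightarrow> ((complex \<Rightarrow> complex) \<Rightarrow> complex) \<Rightarrow> complex set \<Rightarrow> complex" where
  "hecke_at k L \<omega> v =
     (if \<forall>\<sigma> \<in> inertia k L v. \<omega> \<sigma> = 1 then \<omega> (SOME \<sigma>. \<sigma> \<in> frobenius k L v) else 0)"

definition hecke_ideal :: "complex set \<Rightarrow> (complex set \<Rightarrow> complex) \<Rightarrow> complex set \<Rightarrow> complex" where
  "hecke_ideal k \<psi> I = (\<Prod>v \<in> {v \<in> primes_of k. I \<subseteq> v}. \<psi> v ^ ideal_ord k v I)"

text \<open>
  There is no sign condition on \<open>x\<close> at the real place of \<open>\<rat>\<close>: the characters that occur have odd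
  order, hence are even. The conductor is the largest modulus, that is, the union of all.
\<close>

definition modulus :: "complex set \<Rightarrow> (complex set \<Rightarrow> complex) \<Rightarrow> complex set \<Rightarrow> bool" where
  "modulus k \<psi> \<mm> \<longleftrightarrow> ideal \<mm> (ring_on (integers_of k)) \<and> \<mm> \<noteq> {0} \<and>
     (\<forall>x \<in> integers_of k. x \<noteq> 0 \<and> x - 1 \<in> \<mm> \<longrightarrow> hecke_ideal k \<psi> (principal_ideal k x) = 1)"

definition conductor :: "complex set \<Rightarrow> (complex set \<Rightarrow> complex) \<Rightarrow> complex set" where
  "conductor k \<psi> = \<Union> {\<mm>. modulus k \<psi> \<mm>}"

definition field_trace :: "complex set \<Rightarrow> complex \<Rightarrow> complex" where
  "field_trace k x = (\<Sum>\<sigma> \<in> carrier (gal \<rat> k). \<sigma> x)"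

text \<open>
  \<open>\<Sum> \<psi>(x\<ff>) exp(2 \<pi> i Tr(x))\<close> over the classes \<open>x\<close> of \<open>\<ff>\<inverse>/\<O>\<close> with \<open>x\<ff>\<close> prime to the conductor \<open>\<ff>\<close>.
  For \<open>k = \<rat>\<close> and \<open>\<ff> = (m)\<close> this is the classical \<open>\<Sum> \<psi>(a) exp(2 \<pi> i a/m)\<close>. The different of \<open>k\<close>,
  which is prime to \<open>\<ff>\<close>, is deliberately left out: for \<open>p = \<pp>\<qq>\<close> split in \<open>k\<close> the sum attached to
  \<open>\<psi> \<circ> N\<close> is then exactly the square of the one attached to \<open>\<psi>\<close>. Including it would multiply
  two-variable L-functions by the group element of the different.
\<close>

definition gauss_sum :: "complex set \<Rightarrow> (complex set \<Rightarrow> complex) \<Rightarrow> complex" where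
  "gauss_sum k \<psi> =
     (let \<O> = integers_of k; \<ff> = conductor k \<psi>;
          \<ff>inv = {x \<in> k. \<forall>y\<in>\<ff>. x * y \<in> \<O>};
          generic = (\<lambda>x. x \<noteq> 0 \<and> (\<exists>y\<in>\<ff>. \<exists>z\<in>\<ff>. x * y + z = 1))
      in \<Sum>C \<in> {C \<in> (\<lambda>x. (+) x ` \<O>) ` \<ff>inv. \<exists>x\<in>C. generic x}.
           let x = (SOME x. x \<in> C \<and> generic x)
           in hecke_ideal k \<psi> ((*) x ` \<ff>) * exp (2 * of_real pi * \<i> * field_trace k x))"

text \<open>\<open>power_sum t d n\<close> is \<open>x\<^sup>n + y\<^sup>n\<close> for the roots \<open>x, y\<close> of \<open>T\<^sup>2 - t T + d\<close>.\<close>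

fun power_sum :: "complex \<Rightarrow> complex \<Rightarrow> nat \<Rightarrow> complex" where
  "power_sum t d 0 = 2"
| "power_sum t d (Suc 0) = t"
| "power_sum t d (Suc (Suc n)) = t * power_sum t d (Suc n) - d * power_sum t d n"

text \<open>
  The value at \<open>s = 1\<close> of the L-function of the base change to \<open>k\<close> of a weight 2 eigenform with
  coefficients \<open>a\<close> and nebentype \<open>\<epsilon>\<close>, twisted by \<open>\<psi>\<close>. For \<open>k = \<rat>\<close> the Euler product is that of
  the Dirichlet series \<open>\<Sum> a\<^sub>n \<psi>(n) n\<^sup>-\<^sup>s\<close>. It converges in a right half plane and the value is that
  of its entire continuation.
\<close>

definition euler_factor ::
    "complex set \<Rightarrow> (nat \<Rightarrow> complex) \<Rightarrow> (int \<Rightarrow> complex) \<Rightarrow> (complex set \<Rightarrow> complex) \<Rightarrow>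
     complex set \<Rightarrow> complex \<Rightarrow> complex" where
  "euler_factor k a \<epsilon> \<psi> v s =
     (let l = residue_char v; q = ideal_norm k v; f = multiplicity l q
      in 1 - power_sum (a l) (\<epsilon> (int l) * of_nat l) f * \<psi> v * of_nat q powr (- s)
           + \<epsilon> (int l) ^ f * (\<psi> v)\<^sup>2 * of_nat q powr (1 - 2 * s))"

definition L_value ::
    "complex set \<Rightarrow> (nat \<Rightarrow> complex) \<Rightarrow> (int \<Rightarrow> complex) \<Rightarrow> (complex set \<Rightarrow> complex) \<Rightarrow> complex" where
  "L_value k a \<epsilon> \<psi> =
     (THE z. \<exists>g. g holomorphic_on UNIV \<and> z = g 1 \<and>
        (\<exists>r::real. \<forall>s. Re s > r \<longrightarrow>
           (\<lambda>n. \<Prod>v \<in> {v \<in> primes_of k. ideal_norm k v \<le> n}. inverse (euler_factor k a \<epsilon> \<psi> v s))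
             \<longlonglongrightarrow> g s))"


section \<open>Modular forms of weight 2\<close>

definition dirichlet_character :: "nat \<Rightarrow> (int \<Rightarrow> complex) \<Rightarrow> bool" where
  "dirichlet_character N \<epsilon> \<longleftrightarrow>
     (\<forall>m n. \<epsilon> (m * n) = \<epsilon> m * \<epsilon> n) \<and> (\<forall>m. \<epsilon> (m + int N) = \<epsilon> m) \<and>
     (\<forall>m. \<epsilon> m = 0 \<longleftrightarrow> \<not> coprime m (int N))"

definition q_series :: "(nat \<Rightarrow> complex) \<Rightarrow> complex \<Rightarrow> complex" where
  "q_series a z = suminf (\<lambda>n. a n * exp (2 * of_real pi * \<i> * of_nat n * z))"

definition cusp_form_weight2 :: "nat \<Rightarrow> (int \<Rightarrow> complex) \<Rightarrow> (nat \<Rightarrow> complex) \<Rightarrow> bool" where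
  "cusp_form_weight2 N \<epsilon> a \<longleftrightarrow>
     a 0 = 0 \<and>
     (\<forall>z. Im z > 0 \<longrightarrow> summable (\<lambda>n. a n * exp (2 * of_real pi * \<i> * of_nat n * z))) \<and>
     (\<forall>A B C D :: int. A * D - B * C = 1 \<and> int N dvd C \<longrightarrow>
        (\<forall>z. Im z > 0 \<longrightarrow>
           q_series a ((of_int A * z + of_int B) / (of_int C * z + of_int D)) =
             \<epsilon> D * (of_int C * z + of_int D)\<^sup>2 * q_series a z)) \<and>
     (\<forall>A B C D :: int. A * D - B * C = 1 \<longrightarrow>
        ((\<lambda>z. q_series a ((of_int A * z + of_int B) / (of_int C * z + of_int D))
               / (of_int C * z + of_int D)\<^sup>2) \<longlongrightarrow> 0) (filtercomap Im at_top))"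

text \<open>Eigenvector of all Hecke operators, through their action on q-expansions, with \<open>a\<^sub>1 = 1\<close>.\<close>

definition normalized_eigenform_weight2 :: "nat \<Rightarrow> (int \<Rightarrow> complex) \<Rightarrow> (nat \<Rightarrow> complex) \<Rightarrow> bool" where
  "normalized_eigenform_weight2 N \<epsilon> a \<longleftrightarrow>
     cusp_form_weight2 N \<epsilon> a \<and> a 1 = 1 \<and>
     (\<forall>m\<ge>1. \<exists>c. \<forall>n\<ge>1. (\<Sum>d | d dvd gcd m n. \<epsilon> (int d) * of_nat d * a (m * n div d\<^sup>2)) = c * a n)"

text \<open>Coefficients and nebentype of \<open>f\<^sup>(\<^sup>K\<^sup>) = \<Sum> a\<^sub>n \<epsilon>\<^sub>K(n) q\<^sup>n\<close>; the square accounts for primes ramified in \<open>K\<close>.\<close>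

definition twist_coeffs :: "complex set \<Rightarrow> (nat \<Rightarrow> complex) \<Rightarrow> nat \<Rightarrow> complex" where
  "twist_coeffs K a n = a n * quadratic_char K n"

definition twist_nebentype :: "complex set \<Rightarrow> (int \<Rightarrow> complex) \<Rightarrow> int \<Rightarrow> complex" where
  "twist_nebentype K \<epsilon> n = \<epsilon> n * (quadratic_char K (nat \<bar>n\<bar>))\<^sup>2"


section \<open>p-adic L-functions\<close>

text \<open>
  The algebraic part of the value at 1 for the character \<open>\<omega>\<close> of \<open>Gal(L/k)\<close>, and the interpolated
  value, where \<open>lam v\<close> is the root of \<open>X\<^sup>2 - a\<^sub>p X + \<epsilon>(p) p\<close> used at the prime \<open>v\<close> above \<open>p\<close>.
\<close>

definition algebraic_L_value ::
    "complex set \<Rightarrow> complex set \<Rightarrow> (nat \<Rightarrow> complex) \<Rightarrow> (int \<Rightarrow> complex) \<Rightarrow> complex \<Rightarrow>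
     ((complex \<Rightarrow> complex) \<Rightarrow> complex) \<Rightarrow> complex" where
  "algebraic_L_value k L a \<epsilon> \<Omega> \<omega> =
     gauss_sum k (hecke_at k L \<omega>) * L_value k a \<epsilon> (hecke_at k L (\<lambda>\<sigma>. inverse (\<omega> \<sigma>))) / \<Omega>"

definition p_multiplier ::
    "nat \<Rightarrow> (complex \<Rightarrow> 'c::field) \<Rightarrow> complex set \<Rightarrow> complex set \<Rightarrow> (int \<Rightarrow> complex) \<Rightarrow>
     (complex set \<Rightarrow> 'c) \<Rightarrow> ((complex \<Rightarrow> complex) \<Rightarrow> complex) \<Rightarrow> 'c" where
  "p_multiplier p \<iota> k L \<epsilon> lam \<omega> =
     (let \<psi> = hecke_at k L \<omega>; \<psi>' = hecke_at k L (\<lambda>\<sigma>. inverse (\<omega> \<sigma>))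
      in \<Prod>v \<in> {v \<in> primes_of k. of_nat p \<in> v}.
           if \<psi> v = 0 then inverse (lam v) ^ ideal_ord k v (conductor k \<psi>)
           else (1 - \<iota> (\<psi>' v * \<epsilon> (int p)) / lam v) * (1 - \<iota> (\<psi> v) / lam v))"

text \<open>
  The p-adic L-function of Amice-Velu and Vishik on the Galois group of the cyclotomic
  \<open>\<int>\<^sub>p\<close>-extension \<open>Qcyc\<close> with topological generator \<open>\<gamma>\<close>: the distribution of order \<open>v\<^sub>p(lam)\<close>
  with the given values at finite-order characters (unique if \<open>v\<^sub>p(lam) < 1\<close>).
\<close>

definition padic_L1 ::
    "nat \<Rightarrow> (complex \<Rightarrow> 'c::{field_char_0,metric_space}) \<Rightarrow> 'c set \<Rightarrow> complex set \<Rightarrow> (complex \<Rightarrow> complex) \<Rightarrow>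
     (nat \<Rightarrow> complex) \<Rightarrow> (int \<Rightarrow> complex) \<Rightarrow> complex \<Rightarrow> 'c \<Rightarrow> 'c fps \<Rightarrow> bool" where
  "padic_L1 p \<iota> F Qcyc \<gamma> a \<epsilon> \<Omega> lam L \<longleftrightarrow>
     coeffs_in F L \<and> has_order (real_of_ereal (vp p lam)) L \<and>
     (\<forall>\<omega>. finite_order_char \<rat> Qcyc \<omega> \<longrightarrow>
        algebraic (algebraic_L_value \<rat> Qcyc a \<epsilon> \<Omega> \<omega>) \<and>
        eval1 L (\<iota> (\<omega> \<gamma>) - 1) =
          p_multiplier p \<iota> \<rat> Qcyc \<epsilon> (\<lambda>_. lam) \<omega> * \<iota> (algebraic_L_value \<rat> Qcyc a \<epsilon> \<Omega> \<omega>))"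

text \<open>Loeffler's two-variable p-adic L-function, with \<open>lam\<close> used at \<open>\<pp>\<close> and \<open>mu\<close> at \<open>\<qq>\<close>.\<close>

definition padic_L2 ::
    "nat \<Rightarrow> (complex \<Rightarrow> 'c::{field_char_0,metric_space}) \<Rightarrow> 'c set \<Rightarrow> complex set \<Rightarrow> complex set \<Rightarrow> complex set \<Rightarrow>
     (complex \<Rightarrow> complex) \<Rightarrow> (complex \<Rightarrow> complex) \<Rightarrow>
     (nat \<Rightarrow> complex) \<Rightarrow> (int \<Rightarrow> complex) \<Rightarrow> complex \<Rightarrow> 'c \<Rightarrow> 'c \<Rightarrow> 'c fps fps \<Rightarrow> bool" where
  "padic_L2 p \<iota> F K \<pp> Kinf \<gamma>\<^sub>p \<gamma>\<^sub>q a \<epsilon> \<Omega> lam mu L \<longleftrightarrow>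
     coeffs_in2 F L \<and> has_order2 (real_of_ereal (vp p lam)) (real_of_ereal (vp p mu)) L \<and>
     (\<forall>\<omega>. finite_order_char K Kinf \<omega> \<longrightarrow>
        algebraic (algebraic_L_value K Kinf a \<epsilon> \<Omega> \<omega>) \<and>
        eval2 L (\<iota> (\<omega> \<gamma>\<^sub>p) - 1) (\<iota> (\<omega> \<gamma>\<^sub>q) - 1) =
          p_multiplier p \<iota> K Kinf \<epsilon> (\<lambda>v. if v = \<pp> then lam else mu) \<omega> *
          \<iota> (algebraic_L_value K Kinf a \<epsilon> \<Omega> \<omega>))"

end

theory Submission
  imports Defs "HOL-Number_Theory.Residues"
begin

text \<open>
  Let \<open>m\<^sub>1, m\<^sub>2\<close> be the first column of \<open>M\<close>. Specialising the matrix identity to \<open>\<Gamma>\<close>, the hypothesis on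
  \<open>L\<^sub>\<alpha>\<^sub>\<alpha>\<close> becomes \<open>x m\<^sub>1\<^sup>2 + y m\<^sub>1 m\<^sub>2 + z m\<^sub>2\<^sup>2 = 0\<close>, where \<open>x, y, z\<close> are the differences of the
  integral power series to be compared. So it suffices that \<open>m\<^sub>1, m\<^sub>2\<close> satisfy no non-trivial quadratic
  relation with bounded coefficients. This is shown with Gauss norms. At the radius of the primitive
  \<open>p\<^sup>n\<close>-th roots of unity, the matrices \<open>C\<^sub>n\<^sub>-\<^sub>1, \<dots>, C\<^sub>1\<close> make \<open>m\<^sub>2\<close> dominate \<open>m\<^sub>1\<close> by a fixed factor if \<open>n\<close>
  is even and conversely if \<open>n\<close> is odd; here \<open>v\<^sub>p(a\<^sub>p) > 1/p\<close> is used. In a relation as above, even \<open>n\<close>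
  make \<open>z\<close> smaller than the largest coefficient, odd \<open>n\<close> make \<open>x\<close> smaller, and radii in between at which
  \<open>m\<^sub>1\<close> and \<open>m\<^sub>2\<close> have the same norm make \<open>y\<close> smaller, so that all coefficients vanish.
\<close>

no_notation fps_nth (infixl \<open>$\<close> 75)

section \<open>Specialisation to the cyclotomic line\<close>

lemma cyc_add: "cyc (A + B) = cyc A + cyc B"
  by (rule fps_ext) (simp add: cyc_def sum.distrib)

text \<open>Setting both variables equal to X respects products. With a factor in the inner variable
  alone, both sides run over the same pairs of indices, grouped once by the outer index of
  \<open>A\<close> and once by the degree in \<open>cyc A\<close>.\<close>

lemma cyc_mult_in_q_variable:
  fixes A :: "'c::comm_ring_1 fps fps"
  shows "cyc (A * in_q_variable g) = cyc A * g"
proof (rule fps_ext)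
  fix n
  have "fps_nth (cyc (A * in_q_variable g)) n
      = (\<Sum>i\<le>n. \<Sum>j\<le>n - i. fps_nth (fps_nth A i) j * fps_nth g (n - i - j))"
    by (simp add: cyc_def in_q_variable_def fps_mult_right_const_nth) (simp add: fps_mult_nth atLeast0AtMost)
  also have "\<dots> = (\<Sum>k\<le>n. \<Sum>i\<le>k. fps_nth (fps_nth A i) (k - i) * fps_nth g (n - i - (k - i)))"
    by (simp add: sum.Sigma)
      (rule sum.reindex_bij_witness [of _ "\<lambda>(k, i). (i, k - i)" "\<lambda>(i, j). (i + j, i)"], auto)
  also have "\<dots> = fps_nth (cyc A * g) n"
    by (simp add: cyc_def fps_mult_nth atLeast0AtMost sum_distrib_right)
  finally show "fps_nth (cyc (A * in_q_variable g)) n = fps_nth (cyc A * g) n" .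
qed

lemma cyc_in_p_variable_mult:
  fixes A :: "'c::comm_ring_1 fps fps"
  shows "cyc (in_p_variable f * A) = f * cyc A"
proof (rule fps_ext)
  fix n
  have "fps_nth (in_p_variable f * A) i = (\<Sum>k\<le>i. fps_const (fps_nth f k) * fps_nth A (i - k))" for i
    by (simp add: in_p_variable_def fps_mult_nth atLeast0AtMost)
  then have "fps_nth (cyc (in_p_variable f * A)) n
      = (\<Sum>i\<le>n. \<Sum>k\<le>i. fps_nth f k * fps_nth (fps_nth A (i - k)) (n - i))"
    by (simp add: cyc_def fps_sum_nth)
  also have "\<dots> = (\<Sum>k\<le>n. \<Sum>j\<le>n - k. fps_nth f k * fps_nth (fps_nth A j) (n - k - j))"
    by (simp add: sum.Sigma)
      (rule sum.reindex_bij_witness [of _ "\<lambda>(k, j). (k + j, k)" "\<lambda>(i, k). (k, i - k)"], auto)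
  also have "\<dots> = fps_nth (f * cyc A) n"
    by (simp add: cyc_def fps_mult_nth atLeast0AtMost sum_distrib_left)
  finally show "fps_nth (cyc (in_p_variable f * A)) n = fps_nth (f * cyc A) n" .
qed

lemma cyc_triple: "cyc (in_p_variable f * A * in_q_variable g) = f * cyc A * (g :: 'c::comm_ring_1 fps)"
  by (simp add: cyc_mult_in_q_variable cyc_in_p_variable_mult)

section \<open>Entries of the specialised matrix factorisation\<close>

lemma mat2_nth [simp]:
  "mat2 a b c d $ 1 $ 1 = a" "mat2 a b c d $ 1 $ 2 = b" "mat2 a b c d $ 2 $ 1 = c" "mat2 a b c d $ 2 $ 2 = d"
  by (simp_all add: mat2_def)

lemma vector2_eq_iff: "(vector [a, b] :: 'a::zero^2) = w \<longleftrightarrow> a = w $ 1 \<and> b = w $ 2"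
  by (auto simp: vec_eq_iff forall_2)

lemma vector2_mult_matrix_nth:
  "((vector [a, b] :: 'a::comm_semiring_1^2) v* M) $ j = a * M $ 1 $ j + b * M $ 2 $ j"
  by (simp add: vector_matrix_mult_def sum_2 mult.commute)

text \<open>Under specialisation the two outer factors become the transpose of \<open>M\<close> and
  \<open>M\<close> itself. A diagonal entry is therefore a quadratic form in one column of
  \<open>M\<close>, an off-diagonal entry is bilinear in the two columns.\<close>

lemma cyc_factorisation_nth:
  fixes M :: "('c::comm_ring_1 fps)^2^2"
  shows "cyc ((transpose (map_matrix in_p_variable M) ** mat2 A B C D ** map_matrix in_q_variable M) $ i $ j) =
    M $ 1 $ i * cyc A * M $ 1 $ j + M $ 2 $ i * cyc C * M $ 1 $ j +
    (M $ 1 $ i * cyc B * M $ 2 $ j + M $ 2 $ i * cyc D * M $ 2 $ j)"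
proof -
  have "(transpose (map_matrix in_p_variable M) ** mat2 A B C D ** map_matrix in_q_variable M) $ i $ j =
    (in_p_variable (M $ 1 $ i) * A + in_p_variable (M $ 2 $ i) * C) * in_q_variable (M $ 1 $ j) +
    (in_p_variable (M $ 1 $ i) * B + in_p_variable (M $ 2 $ i) * D) * in_q_variable (M $ 2 $ j)"
    by (simp only: matrix_matrix_mult_def transpose_def nth_map_matrix sum_2 vec_lambda_beta mat2_nth)
  then show ?thesis by (simp only: distrib_right cyc_add cyc_triple)
qed

section \<open>Gauss norms\<close>

lemma frequently_at_left_1:
  "(\<exists>\<^sub>F r in at_left (1::real). P r) \<longleftrightarrow> (\<forall>b<1. \<exists>r. b < r \<and> r < 1 \<and> P r)"
  unfolding frequently_def eventually_at_left_field by auto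

text \<open>The absolute value is a parameter because \<open>absp\<close> obeys these laws by the
  hypothesis \<open>padic_complex_numbers\<close>, not by virtue of its type.\<close>

locale nonarch_abs =
  fixes v :: "'a::field \<Rightarrow> real"
  assumes v_nonneg [simp]: "0 \<le> v x"
    and v_eq_0_iff [simp]: "v x = 0 \<longleftrightarrow> x = 0"
    and v_mult: "v (x * y) = v x * v y"
    and v_add: "v (x + y) \<le> max (v x) (v y)"
begin

lemma v_0 [simp]: "v 0 = 0"
  by simp

lemma v_pos_iff [simp]: "0 < v x \<longleftrightarrow> x \<noteq> 0"
  using v_nonneg [of x] v_eq_0_iff [of x] by linarith

lemma v_1 [simp]: "v 1 = 1"
proof -
  have "v 1 * v 1 = v 1 * 1" using v_mult [of 1 1] by simp
  moreover have "v 1 \<noteq> 0" by simp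
  ultimately show ?thesis by auto
qed

lemma v_minus [simp]: "v (- x) = v x"
proof -
  have "v (- 1) * v (- 1) = 1" using v_mult [of "- 1" "- 1"] by simp
  then have "(v (- 1))\<^sup>2 = 1" by (simp add: power2_eq_square)
  then have "v (- 1) = 1" using v_nonneg [of "- 1"] by (auto simp: power2_eq_1_iff)
  then show ?thesis using v_mult [of "- 1" x] by simp
qed

lemma v_diff: "v (x - y) \<le> max (v x) (v y)"
  using v_add [of x "- y"] by simp

lemma v_power: "v (x ^ n) = v x ^ n"
  by (induction n) (simp_all add: v_mult)

lemma v_inverse: "v (inverse x) = inverse (v x)"
proof (cases "x = 0")
  case False
  then have "v x * v (inverse x) = 1" by (simp flip: v_mult)
  with False show ?thesis by (simp add: field_simps)
qed simp

lemma v_sum_le: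
  assumes "\<And>i. i \<in> A \<Longrightarrow> v (f i) \<le> B" "0 \<le> B"
  shows "v (sum f A) \<le> B"
  using assms
proof (induction A rule: infinite_finite_induct)
  case (insert i A)
  then show ?case using v_add [of "f i" "sum f A"] by force
qed auto

lemma v_of_nat_le_1: "v (of_nat n) \<le> 1"
proof (induction n)
  case (Suc n)
  then show ?case using v_add [of 1 "of_nat n"] by simp
qed simp

section \<open>Series on the open unit disc and their Gauss norms\<close>

definition disc :: "'a fps \<Rightarrow> bool" where
  "disc f \<longleftrightarrow> (\<forall>r. 0 < r \<and> r < 1 \<longrightarrow> bdd_above (range (\<lambda>n. v (fps_nth f n) * r ^ n)))"

text \<open>The non-archimedean counterpart of the maximum modulus on the circle of radius r.
  Boundedness of the terms at every radius below 1, as in \<open>disc\<close>, makes them tend to 0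
  at every smaller radius.\<close>

definition gauss_norm :: "real \<Rightarrow> 'a fps \<Rightarrow> real" where
  "gauss_norm r f = (SUP n. v (fps_nth f n) * r ^ n)"

lemma discD: "disc f \<Longrightarrow> 0 < r \<Longrightarrow> r < 1 \<Longrightarrow> bdd_above (range (\<lambda>n. v (fps_nth f n) * r ^ n))"
  by (simp add: disc_def)

lemma gauss_norm_ge: "disc f \<Longrightarrow> 0 < r \<Longrightarrow> r < 1 \<Longrightarrow> v (fps_nth f n) * r ^ n \<le> gauss_norm r f"
  unfolding gauss_norm_def by (rule cSUP_upper) (simp_all add: discD)

lemma gauss_norm_le: "(\<And>n. v (fps_nth f n) * r ^ n \<le> B) \<Longrightarrow> gauss_norm r f \<le> B"
  unfolding gauss_norm_def by (rule cSUP_least) simp_all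

lemma discI:
  assumes "\<And>r. 0 < r \<Longrightarrow> r < 1 \<Longrightarrow> \<exists>B. \<forall>n. v (fps_nth f n) * r ^ n \<le> B"
  shows "disc f"
  unfolding disc_def
proof (intro allI impI)
  fix r :: real assume "0 < r \<and> r < 1"
  then obtain B where "\<forall>n. v (fps_nth f n) * r ^ n \<le> B" using assms by blast
  then show "bdd_above (range (\<lambda>n. v (fps_nth f n) * r ^ n))" by (auto intro: bdd_aboveI)
qed

lemma disc_if_bounded:
  assumes "\<And>n. v (fps_nth f n) \<le> B"
  shows "disc f"
proof (rule discI)
  fix r :: real assume r: "0 < r" "r < 1"
  have "v (fps_nth f n) * r ^ n \<le> B * 1" for n
    by (rule mult_mono) (use r assms [of n] order_trans [OF v_nonneg assms] in \<open>auto simp: power_le_one\<close>)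
  then show "\<exists>B. \<forall>n. v (fps_nth f n) * r ^ n \<le> B" by blast
qed

lemma disc_const [simp]: "disc (fps_const a)"
  by (rule disc_if_bounded [where B = "v a"]) (simp add: fps_const_def)

lemma disc_0 [simp]: "disc 0" and disc_1 [simp]: "disc 1"
  using disc_const [of 0] disc_const [of 1] by simp_all

lemma disc_X [simp]: "disc fps_X"
  by (rule disc_if_bounded [where B = 1]) (simp add: fps_X_def)

lemma disc_minus [simp]: "disc f \<Longrightarrow> disc (- f)"
  by (simp add: disc_def)

lemma gauss_norm_nonneg:
  assumes "disc f" "0 < r" "r < 1"
  shows "0 \<le> gauss_norm r f"
  using order_trans [OF _ gauss_norm_ge [OF assms, of 0]] by simp

lemma
  assumes "disc f" "disc g"
  shows disc_add [simp]: "disc (f + g)"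
    and gauss_norm_add: "0 < r \<Longrightarrow> r < 1 \<Longrightarrow> gauss_norm r (f + g) \<le> max (gauss_norm r f) (gauss_norm r g)"
proof -
  have *: "v (fps_nth (f + g) n) * r ^ n \<le> max (gauss_norm r f) (gauss_norm r g)" if r: "0 < r" "r < 1" for n r
  proof -
    have "v (fps_nth (f + g) n) * r ^ n \<le> max (v (fps_nth f n)) (v (fps_nth g n)) * r ^ n"
      using r by (intro mult_right_mono) (auto simp: v_add)
    also have "\<dots> = max (v (fps_nth f n) * r ^ n) (v (fps_nth g n) * r ^ n)"
      using r by (simp add: max_mult_distrib_right)
    also have "\<dots> \<le> max (gauss_norm r f) (gauss_norm r g)"
      using gauss_norm_ge [OF assms(1) r, of n] gauss_norm_ge [OF assms(2) r, of n] by linarith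
    finally show ?thesis .
  qed
  from * show "disc (f + g)" by (blast intro: discI)
  from * show "gauss_norm r (f + g) \<le> max (gauss_norm r f) (gauss_norm r g)" if "0 < r" "r < 1"
    using that by (blast intro: gauss_norm_le)
qed

lemma gauss_norm_minus [simp]: "gauss_norm r (- f) = gauss_norm r f"
  by (simp add: gauss_norm_def)

lemma disc_diff [simp]: "disc f \<Longrightarrow> disc g \<Longrightarrow> disc (f - g)"
  using disc_add [of f "- g"] by simp

lemma gauss_norm_diff: "disc f \<Longrightarrow> disc g \<Longrightarrow> 0 < r \<Longrightarrow> r < 1 \<Longrightarrow> gauss_norm r (f - g) \<le> max (gauss_norm r f) (gauss_norm r g)"
  using gauss_norm_add [of f "- g" r] by simp

text \<open>In an ultrametric sum of unequal sizes the larger summand wins: writing \<open>g\<close>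
  as \<open>(f + g) - f\<close> gives the reverse bound.\<close>

lemma gauss_norm_add_eq:
  assumes "disc f" "disc g" "0 < r" "r < 1" "gauss_norm r f < gauss_norm r g"
  shows "gauss_norm r (f + g) = gauss_norm r g"
proof (rule antisym)
  show "gauss_norm r (f + g) \<le> gauss_norm r g" using gauss_norm_add [OF assms(1-4)] assms(5) by simp
  have "gauss_norm r g \<le> max (gauss_norm r (f + g)) (gauss_norm r f)"
    using gauss_norm_diff [of "f + g" f r] assms by simp
  with assms(5) show "gauss_norm r g \<le> gauss_norm r (f + g)" by linarith
qed

lemma disc_sum: "(\<And>i. i \<in> A \<Longrightarrow> disc (f i)) \<Longrightarrow> disc (sum f A)"
  by (induction A rule: infinite_finite_induct) auto

lemma gauss_norm_0 [simp]: "gauss_norm r 0 = 0"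
  by (simp add: gauss_norm_def)

lemma gauss_norm_sum_le:
  assumes "\<And>i. i \<in> A \<Longrightarrow> disc (f i)" "\<And>i. i \<in> A \<Longrightarrow> gauss_norm r (f i) \<le> B" "0 \<le> B" "0 < r" "r < 1"
  shows "gauss_norm r (sum f A) \<le> B"
  using assms
proof (induction A rule: infinite_finite_induct)
  case (insert i A)
  then show ?case using gauss_norm_add [of "f i" "sum f A" r] disc_sum [of A f] by force
qed auto

lemma
  assumes "disc f" "disc g"
  shows disc_mult [simp]: "disc (f * g)"
    and gauss_norm_mult_le: "0 < r \<Longrightarrow> r < 1 \<Longrightarrow> gauss_norm r (f * g) \<le> gauss_norm r f * gauss_norm r g"
proof -
  have *: "v (fps_nth (f * g) n) * r ^ n \<le> gauss_norm r f * gauss_norm r g" if r: "0 < r" "r < 1" for n r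
  proof -
    \<comment> \<open>Dividing by \<open>r ^ n\<close> first gives one bound valid for all terms of
      the convolution.\<close>
    have "v (fps_nth (f * g) n) \<le> gauss_norm r f * gauss_norm r g / r ^ n"
      unfolding fps_mult_nth
    proof (rule v_sum_le)
      fix i assume "i \<in> {0..n}"
      then have "v (fps_nth f i * fps_nth g (n - i)) * r ^ n
          = (v (fps_nth f i) * r ^ i) * (v (fps_nth g (n - i)) * r ^ (n - i))"
        by (simp add: v_mult mult_ac flip: power_add)
      also have "\<dots> \<le> gauss_norm r f * gauss_norm r g"
        using r assms by (intro mult_mono gauss_norm_ge gauss_norm_nonneg) auto
      finally show "v (fps_nth f i * fps_nth g (n - i)) \<le> gauss_norm r f * gauss_norm r g / r ^ n"
        using r by (simp add: field_simps)
    qed (use r assms in \<open>simp add: gauss_norm_nonneg\<close>)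
    then show ?thesis using r by (simp add: field_simps)
  qed
  from * show "disc (f * g)" by (blast intro: discI)
  from * show "gauss_norm r (f * g) \<le> gauss_norm r f * gauss_norm r g" if "0 < r" "r < 1"
    using that by (blast intro: gauss_norm_le)
qed

lemma disc_power [simp]: "disc f \<Longrightarrow> disc (f ^ n)"
  by (induction n) auto

lemma gauss_norm_const [simp]:
  assumes "0 < r" "r < 1"
  shows "gauss_norm r (fps_const a) = v a"
proof (rule antisym)
  show "gauss_norm r (fps_const a) \<le> v a" by (rule gauss_norm_le) simp
  show "v a \<le> gauss_norm r (fps_const a)" using gauss_norm_ge [of "fps_const a" r 0] assms by simp
qed

lemma gauss_norm_X [simp]:
  assumes "0 < r" "r < 1"
  shows "gauss_norm r fps_X = r"
proof (rule antisym)
  show "gauss_norm r fps_X \<le> r" by (rule gauss_norm_le) (use assms in simp)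
  show "r \<le> gauss_norm r fps_X" using gauss_norm_ge [of "fps_X" r 1] assms by simp
qed

text \<open>A gap between \<open>r\<close> and 1 forces the terms to tend to 0, so the supremum is attained.\<close>

lemma gauss_norm_first_index:
  assumes "disc f" "0 < r" "r < 1" "f \<noteq> 0"
  obtains k where "gauss_norm r f = v (fps_nth f k) * r ^ k" "0 < gauss_norm r f"
    "\<And>i. i < k \<Longrightarrow> v (fps_nth f i) * r ^ i < gauss_norm r f"
proof -
  define t where "t n = v (fps_nth f n) * r ^ n" for n
  obtain l where l: "fps_nth f l \<noteq> 0" using assms(4) by (auto simp: fps_eq_iff)
  obtain s where s: "r < s" "s < 1" using assms(3) dense by blast
  have "t n \<le> gauss_norm s f * (r / s) ^ n" for n
    using gauss_norm_ge [OF assms(1), of s n] s assms(2)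
    by (simp add: t_def power_divide divide_simps mult.commute)
  then have upper: "\<forall>\<^sub>F n in sequentially. t n \<le> gauss_norm s f * (r / s) ^ n" by simp
  have lim: "(\<lambda>n. gauss_norm s f * (r / s) ^ n) \<longlonglongrightarrow> 0"
  proof (rule tendsto_mult_right_zero, rule LIMSEQ_power_zero)
    show "norm (r / s) < 1" using s assms(2) by simp
  qed
  have lower: "\<forall>\<^sub>F n in sequentially. 0 \<le> t n" using assms(2) by (simp add: t_def)
  have "t \<longlonglongrightarrow> 0"
    by (rule tendsto_sandwich [OF lower upper tendsto_const lim])
  moreover have tl: "0 < t l" using l assms(2) by (simp add: t_def)
  ultimately have "\<forall>\<^sub>F n in sequentially. t n < t l" by (rule order_tendstoD)
  then obtain m where m: "\<And>n. n \<ge> m \<Longrightarrow> t n < t l" by (auto simp: eventually_sequentially)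
  \<comment> \<open>The initial segment contains \<open>l\<close>, and all later terms lie below
    \<open>t l\<close>, so this finite maximum bounds every term.\<close>
  define T where "T = Max (t ` {..m + l})"
  have le: "t n \<le> T" for n
  proof (cases "n \<le> m + l")
    case False
    then have "t n \<le> t l" using m [of n] by simp
    also have "\<dots> \<le> T" unfolding T_def by (rule Max_ge) auto
    finally show ?thesis .
  qed (simp add: T_def)
  have "T \<in> t ` {..m + l}" unfolding T_def by (rule Max_in) auto
  then obtain j where j: "t j = T" by auto
  have eq: "gauss_norm r f = T"
  proof (rule antisym)
    show "gauss_norm r f \<le> T" using le by (intro gauss_norm_le) (simp add: t_def)
    show "T \<le> gauss_norm r f" using gauss_norm_ge [OF assms(1-3), of j] j by (simp add: t_def)
  qed
  define k where "k = (LEAST j. t j = T)"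
  have "t k = T" unfolding k_def by (rule LeastI [of _ j]) (rule j)
  moreover have "t i < T" if "i < k" for i
    using le [of i] not_less_Least [of i "\<lambda>j. t j = T"] that unfolding k_def by linarith
  moreover have "0 < T" using tl le [of l] by linarith
  ultimately show ?thesis using that [of k] by (simp add: eq t_def)
qed

lemma gauss_norm_pos: "disc f \<Longrightarrow> 0 < r \<Longrightarrow> r < 1 \<Longrightarrow> f \<noteq> 0 \<Longrightarrow> 0 < gauss_norm r f"
  by (metis gauss_norm_first_index)

text \<open>Gauss's lemma. Let k and l be the first indices at which the norms of \<open>f\<close>
  and \<open>g\<close> are attained. In the coefficient of index k + l of the product, the term
  pairing k with l is strictly larger than all the others, so nothing can cancel it.\<close>

lemma gauss_norm_mult:
  assumes "disc f" "disc g" "0 < r" "r < 1"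
  shows "gauss_norm r (f * g) = gauss_norm r f * gauss_norm r g"
proof (cases "f = 0 \<or> g = 0")
  case False
  obtain k where k: "gauss_norm r f = v (fps_nth f k) * r ^ k" "0 < gauss_norm r f"
      "\<And>i. i < k \<Longrightarrow> v (fps_nth f i) * r ^ i < gauss_norm r f"
    using gauss_norm_first_index [of f r] assms False by metis
  obtain l where l: "gauss_norm r g = v (fps_nth g l) * r ^ l" "0 < gauss_norm r g"
      "\<And>i. i < l \<Longrightarrow> v (fps_nth g i) * r ^ i < gauss_norm r g"
    using gauss_norm_first_index [of g r] assms False by metis
  define t where "t i = fps_nth f i * fps_nth g (k + l - i)" for i
  have vt: "v (t i) * r ^ (k + l) = (v (fps_nth f i) * r ^ i) * (v (fps_nth g (k + l - i)) * r ^ (k + l - i))"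
    if "i \<le> k + l" for i
    using that by (simp add: t_def v_mult mult_ac flip: power_add)
  have tk: "v (t k) * r ^ (k + l) = gauss_norm r f * gauss_norm r g" using vt [of k] k(1) l(1) by simp
  have small: "v (t i) < v (t k)" if "i \<in> {0..k + l} - {k}" for i
  proof -
    have "(v (fps_nth f i) * r ^ i) * (v (fps_nth g (k + l - i)) * r ^ (k + l - i)) < gauss_norm r f * gauss_norm r g"
    proof (cases "i < k")
      case True
      have "(v (fps_nth f i) * r ^ i) * (v (fps_nth g (k + l - i)) * r ^ (k + l - i))
          \<le> (v (fps_nth f i) * r ^ i) * gauss_norm r g"
        using assms by (intro mult_left_mono gauss_norm_ge) auto
      also have "\<dots> < gauss_norm r f * gauss_norm r g" using k(3) [OF True] l(2) by simp
      finally show ?thesis .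
    next
      \<comment> \<open>Here i > k, so the complementary index lies below l and strictness comes
        from \<open>g\<close>.\<close>
      case F: False
      have "(v (fps_nth f i) * r ^ i) * (v (fps_nth g (k + l - i)) * r ^ (k + l - i))
          \<le> gauss_norm r f * (v (fps_nth g (k + l - i)) * r ^ (k + l - i))"
        using assms by (intro mult_right_mono gauss_norm_ge) auto
      also have "\<dots> < gauss_norm r f * gauss_norm r g" proof (rule mult_strict_left_mono)
        show "v (fps_nth g (k + l - i)) * r ^ (k + l - i) < gauss_norm r g" using F that by (intro l(3)) auto
      qed (rule k(2))
      finally show ?thesis .
    qed
    then have "v (t i) * r ^ (k + l) < v (t k) * r ^ (k + l)" using vt [of i] tk that by simp
    then show ?thesis using assms by simp
  qed
  have "v (sum t ({0..k + l} - {k})) < v (t k)"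
  proof (cases "{0..k + l} - {k} = {}")
    case True
    have "0 < v (t k)" using tk k(2) l(2) assms(3) by (metis mult_pos_pos zero_less_mult_pos2 zero_less_power)
    with True show ?thesis by (simp only: sum.empty v_0)
  next
    case ne: False
    have "v (sum t ({0..k + l} - {k})) \<le> Max ((\<lambda>i. v (t i)) ` ({0..k + l} - {k}))"
    proof (rule v_sum_le)
      obtain i where "i \<in> {0..k + l} - {k}" using ne by blast
      then have "v (t i) \<le> Max ((\<lambda>i. v (t i)) ` ({0..k + l} - {k}))" by (intro Max_ge) auto
      then show "0 \<le> Max ((\<lambda>i. v (t i)) ` ({0..k + l} - {k}))" using v_nonneg order_trans by blast
    qed auto
    also have "\<dots> < v (t k)" using ne small by (subst Max_less_iff) auto
    finally show ?thesis .
  qed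
  moreover have "fps_nth (f * g) (k + l) = t k + sum t ({0..k + l} - {k})"
    by (simp add: fps_mult_nth t_def sum.remove [of _ k])
  ultimately have "v (t k) \<le> v (fps_nth (f * g) (k + l))"
    using v_diff [of "t k + sum t ({0..k + l} - {k})" "sum t ({0..k + l} - {k})"] by force
  then have "gauss_norm r f * gauss_norm r g \<le> v (fps_nth (f * g) (k + l)) * r ^ (k + l)"
    using tk assms(3) by (metis mult_right_mono zero_le_power less_imp_le)
  also have "\<dots> \<le> gauss_norm r (f * g)" using assms by (intro gauss_norm_ge) auto
  finally show ?thesis using gauss_norm_mult_le [OF assms] by linarith
qed auto

lemma gauss_norm_power: "disc f \<Longrightarrow> 0 < r \<Longrightarrow> r < 1 \<Longrightarrow> gauss_norm r (f ^ n) = gauss_norm r f ^ n"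
proof (induction n)
  case 0
  then show ?case using gauss_norm_const [of r 1] by simp
qed (simp add: gauss_norm_mult)

text \<open>The Gauss norm is a supremum of the functions \<open>v (fps_nth f n) * r ^ n\<close>,
  which are convex in r, and a convex function on an open interval is continuous.\<close>

lemma continuous_on_gauss_norm:
  assumes "disc f"
  shows "continuous_on {0<..<1} (\<lambda>r. gauss_norm r f)"
proof (rule convex_on_continuous)
  show "convex_on {0<..<1} (\<lambda>r. gauss_norm r f)"
  proof (rule convex_onI)
    fix t x y :: real
    assume t: "0 < t" "t < 1" and xy: "x \<in> {0<..<1}" "y \<in> {0<..<1}"
    show "gauss_norm ((1 - t) *\<^sub>R x + t *\<^sub>R y) f \<le> (1 - t) * gauss_norm x f + t * gauss_norm y f"
    proof (rule gauss_norm_le)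
      fix n
      have "convex_on {0..} (\<lambda>x::real. x ^ n)" 
      proof (cases "even n")
        case True
        then show ?thesis by (rule convex_on_subset [OF convex_power_even]) simp_all
      qed (rule convex_power_odd)
      then have "((1 - t) *\<^sub>R x + t *\<^sub>R y) ^ n \<le> (1 - t) * x ^ n + t * y ^ n"
        using t xy by (intro convex_onD) auto
      then have "v (fps_nth f n) * ((1 - t) *\<^sub>R x + t *\<^sub>R y) ^ n
          \<le> v (fps_nth f n) * ((1 - t) * x ^ n + t * y ^ n)"
        by (rule mult_left_mono) simp
      also have "\<dots> = (1 - t) * (v (fps_nth f n) * x ^ n) + t * (v (fps_nth f n) * y ^ n)"
        by (simp add: algebra_simps)
      also have "\<dots> \<le> (1 - t) * gauss_norm x f + t * gauss_norm y f"
        using t xy assms by (intro add_mono mult_left_mono gauss_norm_ge) auto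
      finally show "v (fps_nth f n) * ((1 - t) *\<^sub>R x + t *\<^sub>R y) ^ n \<le> (1 - t) * gauss_norm x f + t * gauss_norm y f" .
    qed
  qed (simp add: convex_real_interval)
qed simp

lemma gauss_norm_le_coeff_bound:
  assumes "\<And>n. v (fps_nth f n) \<le> B" "0 < r" "r < 1"
  shows "gauss_norm r f \<le> B"
proof (rule gauss_norm_le)
  fix n
  have "v (fps_nth f n) * r ^ n \<le> v (fps_nth f n) * 1"
    using assms by (intro mult_left_mono) (auto simp: power_le_one)
  then show "v (fps_nth f n) * r ^ n \<le> B" using assms(1) [of n] by simp
qed

text \<open>The term of index n alone tends to the size of the n-th coefficient as the radius tends
  to 1, so radii accumulating at 1 suffice to bound the coefficients.\<close>

lemma coeff_le_if_frequently_gauss_norm_le: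
  assumes "disc f" "\<exists>\<^sub>F r in at_left 1. gauss_norm r f \<le> B"
  shows "v (fps_nth f n) \<le> B"
proof (rule ccontr)
  assume "\<not> v (fps_nth f n) \<le> B"
  moreover have "((\<lambda>r. v (fps_nth f n) * r ^ n) \<longlongrightarrow> v (fps_nth f n) * 1 ^ n) (at_left 1)"
    by (intro tendsto_intros)
  ultimately have "\<forall>\<^sub>F r in at_left 1. B < v (fps_nth f n) * r ^ n"
    by (intro order_tendstoD) auto
  then obtain b where b: "b < 1" "\<And>r. b < r \<Longrightarrow> r < 1 \<Longrightarrow> B < v (fps_nth f n) * r ^ n"
    unfolding eventually_at_left_field by blast
  obtain r where r: "max b 0 < r" "r < 1" "gauss_norm r f \<le> B"
    using assms(2) b(1) unfolding frequently_at_left_1 by (metis max_less_iff_conj zero_less_one)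
  show False using gauss_norm_ge [OF assms(1), of r n] b(2) [of r] r by simp
qed

section \<open>Quadratic relations with bounded coefficients\<close>

lemma quadratic_relation_outer_coeff:
  assumes "disc f" "disc g" "g \<noteq> 0" "0 \<le> c" "c < 1"
    and bd: "\<And>n. v (fps_nth x n) \<le> B" "\<And>n. v (fps_nth y n) \<le> B" "\<And>n. v (fps_nth z n) \<le> B"
    and rel: "x * f\<^sup>2 + y * (f * g) + z * g\<^sup>2 = 0"
    and freq: "\<exists>\<^sub>F r in at_left 1. gauss_norm r f \<le> c * gauss_norm r g"
  shows "v (fps_nth z n) \<le> c * B"
proof (rule coeff_le_if_frequently_gauss_norm_le)
  have disc: "disc x" "disc y" "disc z" using bd disc_if_bounded by blast+
  then show "disc z" by simp
  have B: "0 \<le> B" using bd(1) [of 0] v_nonneg order_trans by blast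
  have "\<forall>\<^sub>F r in at_left 1. 0 < r \<and> r < (1::real)"
    unfolding eventually_at_left_field by (rule exI [of _ 0]) auto
  with freq have "\<exists>\<^sub>F r in at_left 1. (0 < r \<and> r < 1) \<and> gauss_norm r f \<le> c * gauss_norm r g"
    by (rule frequently_eventually_conj)
  then show "\<exists>\<^sub>F r in at_left 1. gauss_norm r z \<le> c * B"
  proof (rule frequently_elim1)
    fix r :: real
    assume r: "(0 < r \<and> r < 1) \<and> gauss_norm r f \<le> c * gauss_norm r g"
    define F G where "F = gauss_norm r f" and "G = gauss_norm r g"
    have G: "0 < G" unfolding G_def using assms r by (intro gauss_norm_pos) auto
    have F: "0 \<le> F" unfolding F_def using assms r by (intro gauss_norm_nonneg) auto
    have FG: "F \<le> c * G" using r by (simp add: F_def G_def)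
    moreover have "c * G \<le> G" using G assms(5) by simp
    ultimately have FG1: "F \<le> G" by simp
    have bdr: "gauss_norm r x \<le> B" "gauss_norm r y \<le> B"
      using r bd by (auto intro: gauss_norm_le_coeff_bound)
    have "z * g\<^sup>2 = - (x * f\<^sup>2 + y * (f * g))" using rel by (simp add: algebra_simps eq_neg_iff_add_eq_0)
    then have "gauss_norm r (z * g\<^sup>2) = gauss_norm r (x * f\<^sup>2 + y * (f * g))" by (simp only: gauss_norm_minus)
    then have "gauss_norm r (z * g\<^sup>2) \<le> max (gauss_norm r (x * f\<^sup>2)) (gauss_norm r (y * (f * g)))"
      using gauss_norm_add [of "x * f\<^sup>2" "y * (f * g)" r] r disc assms(1,2) by simp
    then have 1: "gauss_norm r z * (G * G) \<le> max (gauss_norm r x * (F * F)) (gauss_norm r y * (F * G))"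
      using r disc assms by (simp add: gauss_norm_mult gauss_norm_power F_def G_def power2_eq_square)
    \<comment> \<open>In each of the two terms one factor F is at most c G, and the remaining factor
      is at most G. Division by the square of G then bounds z by c B.\<close>
    have "gauss_norm r x * (F * F) \<le> B * ((c * G) * G)" "gauss_norm r y * (F * G) \<le> B * ((c * G) * G)"
      using F G FG FG1 B bdr by (auto intro!: mult_mono)
    with 1 have "gauss_norm r z * (G * G) \<le> B * ((c * G) * G)" by linarith
    then have "gauss_norm r z * (G * G) \<le> (c * B) * (G * G)" by (simp add: mult_ac)
    then show "gauss_norm r z \<le> c * B" using G by simp
  qed
qed

text \<open>If \<open>f\<close> is repeatedly much larger and repeatedly much smaller than \<open>g\<close>, then the two Gauss norms
  agree at radii in between, and there the middle term is bounded by the outer ones.\<close>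

lemma quadratic_relation_contract:
  assumes "disc f" "disc g" "f \<noteq> 0" "g \<noteq> 0" "0 \<le> c" "c < 1"
    and bd: "\<And>n. v (fps_nth x n) \<le> B" "\<And>n. v (fps_nth y n) \<le> B" "\<And>n. v (fps_nth z n) \<le> B"
    and rel: "x * f\<^sup>2 + y * (f * g) + z * g\<^sup>2 = 0"
    and freq1: "\<exists>\<^sub>F r in at_left 1. gauss_norm r f \<le> c * gauss_norm r g"
    and freq2: "\<exists>\<^sub>F r in at_left 1. gauss_norm r g \<le> c * gauss_norm r f"
  shows "v (fps_nth x n) \<le> c * B" "v (fps_nth y n) \<le> c * B" "v (fps_nth z n) \<le> c * B"
proof -
  have disc: "disc x" "disc y" "disc z" using bd disc_if_bounded by blast+
  show z: "v (fps_nth z n) \<le> c * B" for n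
    by (rule quadratic_relation_outer_coeff [OF assms(1,2,4,5,6) bd rel freq1])
  \<comment> \<open>Interchanging f and g interchanges the roles of x and z.\<close>
  have rel': "z * g\<^sup>2 + y * (g * f) + x * f\<^sup>2 = 0" using rel by (simp add: algebra_simps)
  show x: "v (fps_nth x n) \<le> c * B" for n
    by (rule quadratic_relation_outer_coeff [OF assms(2,1,3,5,6) bd(3,2,1) rel' freq2])
  have "\<exists>\<^sub>F r in at_left 1. gauss_norm r y \<le> c * B"
    unfolding frequently_at_left_1
  proof (intro allI impI)
    fix b :: real assume "b < 1"
    then have b': "max b 0 < 1" by simp
    obtain r1 where r1: "max b 0 < r1" "r1 < 1" "gauss_norm r1 f \<le> c * gauss_norm r1 g"
      using freq1 b' unfolding frequently_at_left_1 by blast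
    obtain r2 where r2: "max b 0 < r2" "r2 < 1" "gauss_norm r2 g \<le> c * gauss_norm r2 f"
      using freq2 b' unfolding frequently_at_left_1 by blast
    \<comment> \<open>The sign of h differs at the two radii, so it vanishes in between. Either
      radius may be the larger one, which calls for both forms of the intermediate value
      theorem.\<close>
    define h where "h r = gauss_norm r f - gauss_norm r g" for r
    have h1: "h r1 \<le> 0"
      using r1(3) mult_left_le [of c "gauss_norm r1 g"] gauss_norm_nonneg [of g r1] r1 assms by (simp add: h_def mult.commute)
    have h2: "0 \<le> h r2"
      using r2(3) mult_left_le [of c "gauss_norm r2 f"] gauss_norm_nonneg [of f r2] r2 assms by (simp add: h_def mult.commute)
    have cont: "continuous_on S h" if "S \<subseteq> {0<..<1}" for S
      unfolding h_def using assms that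
      by (intro continuous_on_diff continuous_on_subset [OF continuous_on_gauss_norm]) auto
    obtain r where r: "max b 0 < r" "r < 1" "h r = 0"
    proof (cases "r1 \<le> r2")
      case True
      have "continuous_on {r1..r2} h" using r1 r2 by (intro cont) auto
      then obtain r where "r1 \<le> r" "r \<le> r2" "h r = 0"
        using IVT' [of h r1 0 r2] h1 h2 True by blast
      then show ?thesis using that [of r] r1 r2 by simp
    next
      case False
      have "continuous_on {r2..r1} h" using r1 r2 by (intro cont) auto
      then obtain r where "r2 \<le> r" "r \<le> r1" "h r = 0"
        using IVT2' [of h r1 0 r2] h1 h2 False by (meson linear)
      then show ?thesis using that [of r] r1 r2 by simp
    qed
    define G where "G = gauss_norm r g"
    have G: "0 < G" unfolding G_def using assms r by (intro gauss_norm_pos) auto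
    have F: "gauss_norm r f = G" using r by (simp add: h_def G_def)
    have "y * (f * g) = - (x * f\<^sup>2 + z * g\<^sup>2)" using rel by (simp add: algebra_simps eq_neg_iff_add_eq_0)
    then have "gauss_norm r (y * (f * g)) = gauss_norm r (x * f\<^sup>2 + z * g\<^sup>2)" by (simp only: gauss_norm_minus)
    then have "gauss_norm r (y * (f * g)) \<le> max (gauss_norm r (x * f\<^sup>2)) (gauss_norm r (z * g\<^sup>2))"
      using gauss_norm_add [of "x * f\<^sup>2" "z * g\<^sup>2" r] r disc assms(1,2) by simp
    then have 1: "gauss_norm r y * (G * G) \<le> max (gauss_norm r x * (G * G)) (gauss_norm r z * (G * G))"
      using r disc assms F by (simp add: gauss_norm_mult gauss_norm_power G_def power2_eq_square)
    have "gauss_norm r x * (G * G) \<le> (c * B) * (G * G)" "gauss_norm r z * (G * G) \<le> (c * B) * (G * G)"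
      using G r x z by (auto intro!: mult_right_mono gauss_norm_le_coeff_bound)
    with 1 have "gauss_norm r y * (G * G) \<le> (c * B) * (G * G)" by linarith
    then have "gauss_norm r y \<le> c * B" using G by simp
    with r show "\<exists>r>b. r < 1 \<and> gauss_norm r y \<le> c * B" by auto
  qed
  then show "v (fps_nth y n) \<le> c * B" for n
    by (rule coeff_le_if_frequently_gauss_norm_le [OF disc(2)])
qed

text \<open>The contraction can be iterated: a common bound B on the coefficients improves to c B,
  hence to every power of c.\<close>

lemma quadratic_relation_trivial:
  assumes "disc f" "disc g" "f \<noteq> 0" "g \<noteq> 0" "0 \<le> c" "c < 1"
    and bd: "\<And>n. v (fps_nth x n) \<le> 1" "\<And>n. v (fps_nth y n) \<le> 1" "\<And>n. v (fps_nth z n) \<le> 1"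
    and rel: "x * f\<^sup>2 + y * (f * g) + z * g\<^sup>2 = 0"
    and freq: "\<exists>\<^sub>F r in at_left 1. gauss_norm r f \<le> c * gauss_norm r g" "\<exists>\<^sub>F r in at_left 1. gauss_norm r g \<le> c * gauss_norm r f"
  shows "x = 0" "y = 0" "z = 0"
proof -
  have *: "(\<forall>n. v (fps_nth x n) \<le> c ^ k) \<and> (\<forall>n. v (fps_nth y n) \<le> c ^ k) \<and> (\<forall>n. v (fps_nth z n) \<le> c ^ k)" for k
  proof (induction k)
    case (Suc k)
    then show ?case
      using quadratic_relation_contract [OF assms(1-6) _ _ _ rel freq, of "c ^ k"] by simp
  qed (use bd in simp)
  have zero: "w = 0" if "\<And>k n. v (fps_nth w n) \<le> c ^ k" for w
  proof (rule fps_ext)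
    fix n
    have "v (fps_nth w n) \<le> 0"
      using LIMSEQ_power_zero [of c] assms(5,6) that
      by (intro LIMSEQ_le_const [of "(^) c" 0]) auto
    then show "fps_nth w n = fps_nth 0 n" using v_nonneg [of "fps_nth w n"] by auto
  qed
  show "x = 0" "y = 0" "z = 0" using * by (auto intro!: zero)
qed

end

section \<open>Cyclotomic polynomials\<close>

text \<open>Both sides are the quotient of \<open>(1 + y) ^ n - 1\<close> by y; induction with
  Pascal's rule avoids the division. It serves to expand a cyclotomic polynomial in powers of
  \<open>Y m\<close>.\<close>

lemma sum_powers_one_plus:
  fixes y :: "'a::comm_semiring_1"
  shows "(\<Sum>i<n. (1 + y) ^ i) = (\<Sum>j<n. of_nat (n choose Suc j) * y ^ j)"
proof (induction n)
  case (Suc n)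
  have "(\<Sum>j<Suc n. of_nat (Suc n choose Suc j) * y ^ j)
      = (\<Sum>j<Suc n. of_nat (n choose j) * y ^ j) + (\<Sum>j<Suc n. of_nat (n choose Suc j) * y ^ j)"
    by (simp add: sum.distrib distrib_right del: sum.lessThan_Suc)
  also have "(\<Sum>j<Suc n. of_nat (n choose j) * y ^ j) = (1 + y) ^ n"
    using binomial_ring [of y 1 n] by (simp add: lessThan_Suc_atMost add.commute)
  also have "(\<Sum>j<Suc n. of_nat (n choose Suc j) * y ^ j) = (\<Sum>i<n. (1 + y) ^ i)"
    by (simp add: Suc.IH binomial_eq_0)
  finally show ?case by (simp only: sum.lessThan_Suc add.commute)
qed simp

locale padic_abs = nonarch_abs v for v :: "'a::field_char_0 \<Rightarrow> real" +
  fixes p :: nat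
  assumes prime_p: "Factorial_Ring.prime p" and odd_p: "odd p"
    and v_p: "v (of_nat p) = 1 / real p"
begin

lemma p_ge_3: "3 \<le> p"
proof -
  have "2 \<le> p" using prime_p by (rule prime_ge_2_nat)
  moreover have "p \<noteq> 2" using odd_p by auto
  ultimately show ?thesis by linarith
qed

lemma v_binomial_le:
  assumes "0 < k" "k < p"
  shows "v (of_nat (p choose k)) \<le> 1 / real p"
proof -
  obtain l where l: "p choose k = p * l"
    using dvd_choose_prime [of k p] assms prime_p by (auto elim: dvdE)
  have "v (of_nat (p choose k)) = 1 / real p * v (of_nat l)" by (simp add: l v_mult v_p)
  also have "\<dots> \<le> 1 / real p * 1" by (intro mult_left_mono v_of_nat_le_1) simp
  finally show ?thesis by simp
qed

lemma disc_of_nat [simp]: "disc (of_nat k)"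
  by (simp flip: fps_of_nat)

lemma gauss_norm_of_nat [simp]: "0 < r \<Longrightarrow> r < 1 \<Longrightarrow> gauss_norm r (of_nat k) = v (of_nat k)"
  by (simp flip: fps_of_nat)

lemma disc_Phi [simp]: "disc (Phi p n)"
  unfolding Phi_def by (intro disc_sum disc_power) simp

lemma gauss_norm_Phi_le_1:
  assumes "0 < r" "r < 1"
  shows "gauss_norm r (Phi p n) \<le> 1"
  unfolding Phi_def
proof (rule gauss_norm_sum_le)
  fix i
  have "gauss_norm r (1 + fps_X) \<le> 1"
    using gauss_norm_add [of 1 fps_X r] gauss_norm_const [of r 1] assms by simp
  then show "gauss_norm r ((1 + fps_X) ^ (i * p ^ (n - 1))) \<le> 1"
    using assms gauss_norm_nonneg [of "1 + fps_X" r] by (simp add: gauss_norm_power power_le_one)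
qed (use assms in auto)

text \<open>The zeros of \<open>Y m\<close> are \<zeta> - 1 for the p^m-th roots of unity \<zeta>,
  and \<open>Y m\<close> is X times the product of the first m cyclotomic polynomials
  \<open>Phi p 1\<close>, ..., \<open>Phi p m\<close>.\<close>

definition Y :: "nat \<Rightarrow> 'a fps" where
  "Y m = (1 + fps_X) ^ (p ^ m) - 1"

lemma disc_Y [simp]: "disc (Y m)"
  by (simp add: Y_def)

lemma Y_0: "Y 0 = fps_X"
  by (simp add: Y_def)

lemma Y_Suc: "Y (Suc m) = Phi p (Suc m) * Y m"
  using Phi_times [of "Suc m" p, symmetric] by (simp add: Y_def)

lemma Phi_Suc_eq_sum: "Phi p (Suc m) = (\<Sum>j<p. of_nat (p choose Suc j) * Y m ^ j)"
proof -
  have "Phi p (Suc m) = (\<Sum>i<p. (1 + Y m) ^ i)"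
    unfolding Phi_def by (simp add: Y_def power_mult [symmetric] mult.commute)
  then show ?thesis by (simp add: sum_powers_one_plus)
qed

text \<open>As a polynomial in \<open>Y m\<close>, the cyclotomic polynomial is Eisenstein: leading
  coefficient 1, constant term p, and p divides the binomial coefficients in between. The first
  estimate isolates the leading power, the second also the constant p.\<close>

lemma gauss_norm_Phi_Suc_diff_le:
  assumes "0 < r" "r < 1" "gauss_norm r (Y m) \<le> 1"
  shows "gauss_norm r (Phi p (Suc m) - Y m ^ (p - 1)) \<le> 1 / real p"
    and "gauss_norm r (Phi p (Suc m) - of_nat p - Y m ^ (p - 1)) \<le> gauss_norm r (Y m) / real p"
proof -
  define t where "t j = of_nat (p choose Suc j) * Y m ^ j" for j
  have disc_t: "disc (t j)" for j by (simp add: t_def)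
  have gauss_norm_t: "gauss_norm r (t j) \<le> gauss_norm r (Y m) ^ j / real p" if "j < p - 1" for j
  proof -
    have "gauss_norm r (t j) = v (of_nat (p choose Suc j)) * gauss_norm r (Y m) ^ j"
      using assms by (simp add: t_def gauss_norm_mult gauss_norm_power)
    also have "\<dots> \<le> 1 / real p * gauss_norm r (Y m) ^ j"
      using that assms by (intro mult_right_mono v_binomial_le zero_le_power gauss_norm_nonneg) auto
    finally show ?thesis by simp
  qed
  obtain s where s: "p = Suc (Suc s)" using p_ge_3 that [of "p - 2"] by simp
  have 1: "Phi p (Suc m) = (\<Sum>j<p - 1. t j) + Y m ^ (p - 1)"
  proof -
    have "{..<p} = insert (p - 1) {..<p - 1}" "t (p - 1) = Y m ^ (p - 1)" using s by (auto simp: t_def)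
    then show ?thesis unfolding Phi_Suc_eq_sum t_def [symmetric] by simp
  qed
  have 2: "(\<Sum>j<p - 1. t j) = of_nat p + (\<Sum>j\<in>{1..<p - 1}. t j)"
  proof -
    have "{..<p - 1} = insert 0 {1..<p - 1}" using s by auto
    then show ?thesis by (simp add: t_def)
  qed
  have Y0: "0 \<le> gauss_norm r (Y m)" using assms by (intro gauss_norm_nonneg) auto
  have "gauss_norm r (\<Sum>j<p - 1. t j) \<le> 1 / real p"
  proof (rule gauss_norm_sum_le)
    fix j assume "j \<in> {..<p - 1}"
    then have "gauss_norm r (t j) \<le> gauss_norm r (Y m) ^ j / real p" by (intro gauss_norm_t) auto
    also have "\<dots> \<le> 1 / real p"
      using assms Y0 by (intro divide_right_mono power_le_one) auto
    finally show "gauss_norm r (t j) \<le> 1 / real p" .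
  qed (use assms disc_t in auto)
  with 1 show "gauss_norm r (Phi p (Suc m) - Y m ^ (p - 1)) \<le> 1 / real p" by simp
  have "gauss_norm r (\<Sum>j\<in>{1..<p - 1}. t j) \<le> gauss_norm r (Y m) / real p"
  proof (rule gauss_norm_sum_le)
    fix j assume j: "j \<in> {1..<p - 1}"
    then have "gauss_norm r (t j) \<le> gauss_norm r (Y m) ^ j / real p" by (intro gauss_norm_t) auto
    also have "\<dots> \<le> gauss_norm r (Y m) / real p"
      using assms Y0 j power_decreasing [of 1 j "gauss_norm r (Y m)"] by (intro divide_right_mono) auto
    finally show "gauss_norm r (t j) \<le> gauss_norm r (Y m) / real p" .
  qed (use assms disc_t Y0 in auto)
  with 1 2 show "gauss_norm r (Phi p (Suc m) - of_nat p - Y m ^ (p - 1)) \<le> gauss_norm r (Y m) / real p" by simp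
qed

section \<open>Sizes of the cyclotomic polynomials on the critical circles\<close>

text \<open>This is the radius of the circle through \<open>\<zeta> - 1\<close> for primitive \<open>p\<^sup>n\<close>-th roots of unity \<open>\<zeta>\<close>.\<close>

definition rad :: "nat \<Rightarrow> real" where
  "rad n = (1 / real p) powr (1 / (real p ^ (n - 1) * (real p - 1)))"

lemma rad_pos: "0 < rad n" and rad_less_1: "rad n < 1"
proof -
  show "0 < rad n" using p_ge_3 by (simp add: rad_def)
  have "(1 / real p) powr (1 / (real p ^ (n - 1) * (real p - 1))) < 1 powr (1 / (real p ^ (n - 1) * (real p - 1)))"
    using p_ge_3 by (intro powr_less_mono2) auto
  then show "rad n < 1" by (simp add: rad_def)
qed

text \<open>This will be the norm of \<open>Y m ^ (p - 1)\<close> at the radius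
  \<open>rad n\<close>; for m = n - 1 it is exactly 1/p, the size of the constant term p.\<close>

lemma rad_power:
  assumes "m < n"
  shows "rad n ^ (p ^ m * (p - 1)) = (1 / real p) powr (1 / real p ^ (n - 1 - m))"
proof -
  have "rad n ^ (p ^ m * (p - 1)) = (1 / real p) powr (real (p ^ m * (p - 1)) * (1 / (real p ^ (n - 1) * (real p - 1))))"
    using p_ge_3 by (simp only: rad_def) (simp add: powr_power powr_realpow [symmetric] powr_powr mult.commute)
  also have "real (p ^ m * (p - 1)) * (1 / (real p ^ (n - 1) * (real p - 1))) = 1 / real p ^ (n - 1 - m)"
    using p_ge_3 assms by (simp add: of_nat_diff power_diff)
  finally show ?thesis .
qed

lemma rad_tendsto: "rad \<longlonglongrightarrow> 1"
proof -
  have "(\<lambda>n. (1 / real p) powr (1 / (real p ^ n * (real p - 1)))) \<longlonglongrightarrow> (1 / real p) powr 0"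
  proof (rule tendsto_powr)
    have "(\<lambda>n. (1 / real p) ^ n * (1 / (real p - 1))) \<longlonglongrightarrow> 0 * (1 / (real p - 1))"
      using p_ge_3 by (intro tendsto_mult_right LIMSEQ_power_zero) auto
    then show "(\<lambda>n. 1 / (real p ^ n * (real p - 1))) \<longlonglongrightarrow> 0"
      by (simp add: power_one_over divide_simps)
  qed (use p_ge_3 in auto)
  then have "(\<lambda>n. rad (Suc n)) \<longlonglongrightarrow> 1" using p_ge_3 by (simp add: rad_def)
  then show ?thesis by (simp only: filterlim_sequentially_Suc)
qed

text \<open>Below level n the power \<open>Y m ^ (p - 1)\<close> is larger than 1/p and so
  determines the norm of the next cyclotomic polynomial. The recursion \<open>Y_Suc\<close> then
  carries the norm from \<open>Y m\<close> to \<open>Y (Suc m)\<close>.\<close>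

lemma gauss_norm_Y_eq: "m < n \<Longrightarrow> gauss_norm (rad n) (Y m) = rad n ^ (p ^ m)"
  and gauss_norm_Phi_eq: "Suc m < n \<Longrightarrow> gauss_norm (rad n) (Phi p (Suc m)) = rad n ^ (p ^ m * (p - 1))"
proof -
  note r = rad_pos [of n] rad_less_1 [of n]
  have step: "gauss_norm (rad n) (Phi p (Suc m)) = rad n ^ (p ^ m * (p - 1))"
    if "gauss_norm (rad n) (Y m) = rad n ^ (p ^ m)" "Suc m < n" for m
  proof -
    \<comment> \<open>At level n - 1 this power equals 1/p; a smaller exponent makes it strictly
      larger.\<close>
    have "p ^ m * (p - 1) < p ^ (n - 1) * (p - 1)" using that(2) p_ge_3 by simp
    then have "rad n ^ (p ^ (n - 1) * (p - 1)) < rad n ^ (p ^ m * (p - 1))"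
      using r by (intro power_strict_decreasing) auto
    then have "1 / real p < rad n ^ (p ^ m * (p - 1))"
      using that(2) p_ge_3 rad_power [of "n - 1" n] by simp
    moreover have pw: "gauss_norm (rad n) (Y m ^ (p - 1)) = rad n ^ (p ^ m * (p - 1))"
      using r that(1) by (simp add: gauss_norm_power power_mult)
    moreover have "gauss_norm (rad n) (Phi p (Suc m) - Y m ^ (p - 1)) \<le> 1 / real p"
      using r that(1) by (intro gauss_norm_Phi_Suc_diff_le) (auto simp: power_le_one)
    ultimately show ?thesis
      using gauss_norm_add_eq [of "Phi p (Suc m) - Y m ^ (p - 1)" "Y m ^ (p - 1)" "rad n"] r by simp
  qed
  show Y: "gauss_norm (rad n) (Y m) = rad n ^ (p ^ m)" if "m < n" for m
    using that
  proof (induction m)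
    case (Suc m)
    have "p ^ m * (p - 1) + p ^ m = p ^ Suc m" using p_ge_3 by (cases p) (auto simp: algebra_simps)
    moreover have "gauss_norm (rad n) (Y (Suc m)) = rad n ^ (p ^ m * (p - 1)) * rad n ^ (p ^ m)"
      using Suc r by (simp add: Y_Suc gauss_norm_mult step)
    ultimately show ?case by (simp only: power_add [symmetric])
  qed (use r in \<open>simp add: Y_0\<close>)
  show "gauss_norm (rad n) (Phi p (Suc m)) = rad n ^ (p ^ m * (p - 1))" if "Suc m < n"
    using that by (intro step Y) auto
qed

lemma gauss_norm_Phi_eq_powr:
  assumes "0 < k" "k < n"
  shows "gauss_norm (rad n) (Phi p (n - k)) = (1 / real p) powr (1 / real p ^ k)"
proof -
  obtain m where m: "n - k = Suc m" using assms that [of "n - k - 1"] by simp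
  then have "n - 1 - m = k" using assms by simp
  then show ?thesis using gauss_norm_Phi_eq [of m n] rad_power [of m n] m assms by simp
qed

lemma gauss_norm_Phi_Suc_le_if:
  assumes "0 < r" "r < 1" "gauss_norm r (Y m) \<le> 1" "gauss_norm r (Y m) ^ (p - 1) \<le> 1 / real p"
  shows "gauss_norm r (Phi p (Suc m)) \<le> 1 / real p"
  using gauss_norm_add [of "Phi p (Suc m) - Y m ^ (p - 1)" "Y m ^ (p - 1)" r]
    gauss_norm_Phi_Suc_diff_le(1) [of r m] assms by (simp add: gauss_norm_power)

text \<open>On the circle carrying the zeros of \<open>Phi p n\<close>, the leading power of
  \<open>Y (n - 1)\<close> and the constant p both have size 1/p.\<close>

lemma gauss_norm_Phi_self_le:
  assumes "1 \<le> n"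
  shows "gauss_norm (rad n) (Phi p n) \<le> 1 / real p"
proof -
  note r = rad_pos [of n] rad_less_1 [of n]
  have Y: "gauss_norm (rad n) (Y (n - 1)) = rad n ^ (p ^ (n - 1))" using assms by (intro gauss_norm_Y_eq) auto
  have "gauss_norm (rad n) (Phi p (Suc (n - 1))) \<le> 1 / real p"
  proof (rule gauss_norm_Phi_Suc_le_if)
    show "gauss_norm (rad n) (Y (n - 1)) ^ (p - 1) \<le> 1 / real p"
      using Y rad_power [of "n - 1" n] assms p_ge_3 by (simp add: power_mult [symmetric])
  qed (use r Y in \<open>auto simp: power_le_one\<close>)
  then show ?thesis using assms by simp
qed

text \<open>As p is odd, p - 1 is at least 2. For y at most 1/p the leading power is then at most
  y/p, which is the size of the middle terms.\<close>

lemma power_le_power_p_minus_1: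
  fixes y :: real
  assumes "0 \<le> y" "y \<le> 1"
  shows "y ^ (p - 1) \<le> y\<^sup>2"
  using assms p_ge_3 by (intro power_decreasing) auto

text \<open>From level n on, each factor in the recursion \<open>Y_Suc\<close> contributes at most
  1/p.\<close>

lemma gauss_norm_Y_le:
  assumes "1 \<le> n"
  shows "gauss_norm (rad n) (Y (n + k)) \<le> (1 / real p) ^ (k + 1)"
proof (induction k)
  note r = rad_pos [of n] rad_less_1 [of n]
  case 0
  have "gauss_norm (rad n) (Y n) = gauss_norm (rad n) (Phi p n) * gauss_norm (rad n) (Y (n - 1))"
    using Y_Suc [of "n - 1"] assms r by (simp add: gauss_norm_mult)
  also have "\<dots> \<le> 1 / real p * 1"
    using r assms gauss_norm_Phi_self_le [of n] gauss_norm_Y_eq [of "n - 1" n]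
    by (intro mult_mono gauss_norm_nonneg) (auto simp: power_le_one)
  finally show ?case by simp
next
  note r = rad_pos [of n] rad_less_1 [of n]
  case (Suc k)
  let ?y = "gauss_norm (rad n) (Y (n + k))"
  have y0: "0 \<le> ?y" using r by (intro gauss_norm_nonneg) auto
  have yp: "?y \<le> 1 / real p"
    using Suc p_ge_3 power_decreasing [of 1 "k + 1" "1 / real p"] by simp
  have y1: "?y \<le> 1" using yp by (rule order_trans) (use p_ge_3 in simp)
  have "?y ^ (p - 1) \<le> ?y * 1"
    using power_le_power_p_minus_1 [OF y0 y1] mult_left_mono [OF y1 y0] by (simp add: power2_eq_square)
  then have "gauss_norm (rad n) (Phi p (Suc (n + k))) \<le> 1 / real p"
    using r y1 yp by (intro gauss_norm_Phi_Suc_le_if) auto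
  then have "gauss_norm (rad n) (Phi p (Suc (n + k))) * ?y \<le> 1 / real p * (1 / real p) ^ (k + 1)"
    using Suc y0 by (intro mult_mono) auto
  then show ?case using r by (simp add: Y_Suc gauss_norm_mult)
qed

text \<open>With \<open>Y (n + k)\<close> geometrically small, the constant term p is what remains
  of the cyclotomic polynomial. This rate makes the infinite matrix product converge.\<close>

lemma gauss_norm_Phi_minus_p_le:
  assumes "1 \<le> n"
  shows "gauss_norm (rad n) (Phi p (n + Suc k) - of_nat p) \<le> (1 / real p) ^ (k + 2)"
proof -
  note r = rad_pos [of n] rad_less_1 [of n]
  let ?y = "gauss_norm (rad n) (Y (n + k))"
  have y0: "0 \<le> ?y" using r by (intro gauss_norm_nonneg) auto
  have yk: "?y \<le> (1 / real p) ^ (k + 1)" using assms by (rule gauss_norm_Y_le)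
  moreover have "(1 / real p) ^ (k + 1) \<le> 1 / real p"
    using p_ge_3 power_decreasing [of 1 "k + 1" "1 / real p"] by simp
  ultimately have yp: "?y \<le> 1 / real p" by linarith
  have y1: "?y \<le> 1" using yp by (rule order_trans) (use p_ge_3 in simp)
  have "?y ^ (p - 1) \<le> ?y * (1 / real p)"
    using power_le_power_p_minus_1 [OF y0 y1] mult_left_mono [OF yp y0] by (simp add: power2_eq_square)
  then have "gauss_norm (rad n) (Phi p (Suc (n + k)) - of_nat p) \<le> ?y * (1 / real p)"
    using gauss_norm_add [of "Phi p (Suc (n + k)) - of_nat p - Y (n + k) ^ (p - 1)" "Y (n + k) ^ (p - 1)" "rad n"]
      gauss_norm_Phi_Suc_diff_le(2) [of "rad n" "n + k"] r y1 by (simp add: gauss_norm_power)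
  also have "\<dots> \<le> (1 / real p) ^ (k + 1) * (1 / real p)"
    using yk by (rule mult_right_mono) simp
  finally show ?thesis by (simp add: mult.commute)
qed

end

section \<open>The first column of the logarithm matrix\<close>

text \<open>The numerical data of the Hecke polynomial at p: \<open>absp_ap\<close> expresses that
  a_p has valuation greater than 1/p, and \<open>absp_e\<close> reflects that \<epsilon>(p) is a
  root of unity.\<close>

locale padic_roots =
  fixes p :: nat and ap e \<alpha> \<beta> :: "'c::{field_char_0,complete_space}"
  assumes prime: "Factorial_Ring.prime p" and odd: "odd p"
    and dist_eq: "dist x y = absp (x - y :: 'c)"
    and absp_mult: "absp (x * y :: 'c) = absp x * absp y"
    and absp_add: "absp (x + y :: 'c) \<le> max (absp x) (absp y)"
    and absp_p: "absp (of_nat p :: 'c) = 1 / real p"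
    and absp_e: "absp e = 1"
    and roots_sum: "\<alpha> + \<beta> = ap" and roots_prod: "\<alpha> * \<beta> = e * of_nat p"
    and absp_ap: "absp ap < (1 / real p) powr (1 / real p)"
begin

sublocale padic_abs "absp :: 'c \<Rightarrow> real" p
  by unfold_locales (use absp_mult absp_add absp_p prime odd in \<open>auto simp: absp_def\<close>)

lemma absp_roots_mult: "absp \<alpha> * absp \<beta> = 1 / real p"
  using arg_cong [OF roots_prod, of absp] by (simp add: v_mult absp_e absp_p)

text \<open>If y were at least as large as \<open>?t\<close>, then so would be x, since their sum
  \<open>ap\<close> is smaller. The product would have size at least
  \<open>(1 / real p) powr (2 / real p)\<close>, which exceeds 1/p because 2/p < 1.\<close>

lemma absp_root_less:
  assumes "x + y = ap" "absp x * absp y = 1 / real p"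
  shows "absp y < (1 / real p) powr (1 / real p)"
proof (rule ccontr)
  let ?t = "(1 / real p) powr (1 / real p)"
  assume "\<not> absp y < ?t"
  then have y: "?t \<le> absp y" by simp
  have "absp y \<le> max (absp ap) (absp x)"
    using v_diff [of ap x] by (simp flip: assms(1))
  with y absp_ap have x: "?t \<le> absp x" by linarith
  have "?t * ?t \<le> absp x * absp y" using x y by (intro mult_mono) auto
  moreover have "(1 / real p) powr 1 < (1 / real p) powr (2 / real p)"
    using p_ge_3 by (intro powr_less_mono') auto
  moreover have "?t * ?t = (1 / real p) powr (2 / real p)" by (simp flip: powr_add)
  ultimately show False using assms(2) p_ge_3 by simp
qed

lemma absp_beta_less: "absp \<beta> < (1 / real p) powr (1 / real p)"
  using absp_root_less [OF roots_sum absp_roots_mult] .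

lemma powr_less_1: "(1 / real p) powr (1 / real p ^ k) < 1"
  using p_ge_3 powr_less_mono2 [of "1 / real p ^ k" "1 / real p" 1] by simp

lemma absp_beta_less_1: "absp \<beta> < 1" and absp_ap_less_1: "absp ap < 1"
  using absp_beta_less absp_ap powr_less_1 [of 1] by simp_all

lemma alpha_nonzero: "\<alpha> \<noteq> 0" and beta_nonzero: "\<beta> \<noteq> 0"
  using absp_roots_mult p_ge_3 by auto

lemma absp_alpha: "absp \<alpha> = 1 / (real p * absp \<beta>)"
  using absp_roots_mult p_ge_3 beta_nonzero by (simp add: field_simps)

section \<open>The matrices acting on column vectors\<close>

definition C_apply :: "nat \<Rightarrow> 'c fps \<times> 'c fps \<Rightarrow> 'c fps \<times> 'c fps" where
  "C_apply m w = (fps_const ap * fst w + snd w, - fps_const e * Phi p m * fst w)"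

text \<open>The product of the matrices with indices s + 1, ..., s + k applied to w, the highest
  index acting first. The offset s allows a product to be split at the level belonging to a
  radius.\<close>

fun C_product :: "nat \<Rightarrow> nat \<Rightarrow> 'c fps \<times> 'c fps \<Rightarrow> 'c fps \<times> 'c fps" where
  "C_product s 0 w = w"
| "C_product s (Suc k) w = C_product s k (C_apply (s + Suc k) w)"

definition scale :: "'c \<Rightarrow> 'c fps \<times> 'c fps \<Rightarrow> 'c fps \<times> 'c fps" where
  "scale a w = (fps_const a * fst w, fps_const a * snd w)"

text \<open>The first column of the matrix A, an eigenvector of C for the eigenvalue
  \<alpha>.\<close>

definition eigenvector :: "'c fps \<times> 'c fps" where
  "eigenvector = (- 1, fps_const \<beta>)"

definition disc_pair :: "'c fps \<times> 'c fps \<Rightarrow> bool" where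
  "disc_pair w \<longleftrightarrow> disc (fst w) \<and> disc (snd w)"

definition pair_norm :: "real \<Rightarrow> 'c fps \<times> 'c fps \<Rightarrow> real" where
  "pair_norm r w = max (gauss_norm r (fst w)) (gauss_norm r (snd w))"

lemma disc_pair_diff: "disc_pair u \<Longrightarrow> disc_pair w \<Longrightarrow> disc_pair (u - w)"
  by (simp add: disc_pair_def)

lemma disc_pair_eigenvector [simp]: "disc_pair eigenvector"
  by (simp add: disc_pair_def eigenvector_def)

lemma disc_pair_scale [simp]: "disc_pair w \<Longrightarrow> disc_pair (scale a w)"
  by (simp add: disc_pair_def scale_def)

lemma disc_pair_C_apply [simp]: "disc_pair w \<Longrightarrow> disc_pair (C_apply m w)"
  unfolding disc_pair_def C_apply_def by simp

lemma disc_pair_C_product [simp]: "disc_pair w \<Longrightarrow> disc_pair (C_product s k w)"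
  by (induction k arbitrary: w) simp_all

lemma pair_norm_scale: "disc_pair w \<Longrightarrow> 0 < r \<Longrightarrow> r < 1 \<Longrightarrow> pair_norm r (scale a w) = absp a * pair_norm r w"
  by (simp add: pair_norm_def scale_def disc_pair_def gauss_norm_mult max_mult_distrib_left)

lemma pair_norm_diff: "disc_pair u \<Longrightarrow> disc_pair w \<Longrightarrow> 0 < r \<Longrightarrow> r < 1 \<Longrightarrow> pair_norm r (u - w) \<le> max (pair_norm r u) (pair_norm r w)"
  using gauss_norm_diff [of "fst u" "fst w" r] gauss_norm_diff [of "snd u" "snd w" r]
  by (auto simp: pair_norm_def disc_pair_def)

lemma gauss_norm_C_apply:
  assumes "disc_pair w" "0 < r" "r < 1"
  shows "gauss_norm r (fst (C_apply m w)) \<le> max (absp ap * gauss_norm r (fst w)) (gauss_norm r (snd w))"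
    and "gauss_norm r (snd (C_apply m w)) = gauss_norm r (Phi p m) * gauss_norm r (fst w)"
proof -
  show "gauss_norm r (fst (C_apply m w)) \<le> max (absp ap * gauss_norm r (fst w)) (gauss_norm r (snd w))"
    using gauss_norm_add [of "fps_const ap * fst w" "snd w" r] assms by (simp add: C_apply_def disc_pair_def gauss_norm_mult)
  have "snd (C_apply m w) = - (fps_const e * (Phi p m * fst w))" by (simp add: C_apply_def mult.assoc del: fps_const_neg)
  then show "gauss_norm r (snd (C_apply m w)) = gauss_norm r (Phi p m) * gauss_norm r (fst w)"
    using assms by (simp add: disc_pair_def gauss_norm_mult absp_e)
qed

text \<open>All entries of these matrices have Gauss norm at most 1.\<close>

lemma pair_norm_C_apply_le:
  assumes "disc_pair w" "0 < r" "r < 1"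
  shows "pair_norm r (C_apply m w) \<le> pair_norm r w"
proof -
  have f: "0 \<le> gauss_norm r (fst w)" using assms by (auto simp: disc_pair_def intro: gauss_norm_nonneg)
  have "absp ap * gauss_norm r (fst w) \<le> gauss_norm r (fst w)"
    using f absp_ap_less_1 by (intro mult_left_le_one_le) auto
  moreover have "gauss_norm r (Phi p m) * gauss_norm r (fst w) \<le> gauss_norm r (fst w)"
    using f assms gauss_norm_Phi_le_1 by (intro mult_left_le_one_le) (auto intro: gauss_norm_nonneg)
  ultimately show ?thesis using gauss_norm_C_apply [OF assms, of m] by (simp add: pair_norm_def) linarith
qed

lemma pair_norm_C_product_le: "disc_pair w \<Longrightarrow> 0 < r \<Longrightarrow> r < 1 \<Longrightarrow> pair_norm r (C_product s k w) \<le> pair_norm r w"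
proof (induction k arbitrary: w)
  case (Suc k)
  then have "pair_norm r (C_product s (Suc k) w) \<le> pair_norm r (C_apply (s + Suc k) w)" by simp
  also have "\<dots> \<le> pair_norm r w" using Suc.prems by (rule pair_norm_C_apply_le)
  finally show ?case .
qed simp

lemma C_apply_diff: "C_apply m (u - w) = C_apply m u - C_apply m w"
  by (simp add: C_apply_def algebra_simps)

lemma C_apply_scale: "C_apply m (scale a w) = scale a (C_apply m w)"
  by (simp add: C_apply_def scale_def algebra_simps)

lemma scale_diff: "scale a (u - w) = scale a u - scale a w"
  by (simp add: scale_def algebra_simps)

lemma scale_scale: "scale a (scale b w) = scale (a * b) w"
  by (simp add: scale_def mult.assoc flip: fps_const_mult)

lemma C_product_diff: "C_product s k (u - w) = C_product s k u - C_product s k w"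
  by (induction k arbitrary: u w) (simp_all add: C_apply_diff)

lemma C_product_scale: "C_product s k (scale a w) = scale a (C_product s k w)"
  by (induction k arbitrary: w) (simp_all add: C_apply_scale)

lemma C_product_add: "C_product 0 (n + k) w = C_product 0 n (C_product n k w)"
  by (induction k arbitrary: w) simp_all

text \<open>The matrix with index m arises from C by replacing p with \<open>Phi p m\<close> in one
  entry, so it fails the eigenvector equation only by a multiple of
  \<open>Phi p m - of_nat p\<close>.\<close>

lemma C_apply_eigenvector: "C_apply m eigenvector - scale \<alpha> eigenvector = (0, fps_const e * (Phi p m - of_nat p))"
proof -
  have prod: "fps_const \<alpha> * fps_const \<beta> = fps_const e * (of_nat p :: 'c fps)"
    by (simp add: roots_prod flip: fps_of_nat)
  have sum: "fps_const ap = fps_const \<alpha> + fps_const \<beta>" by (simp add: roots_sum)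
  show ?thesis
    by (simp add: C_apply_def eigenvector_def scale_def algebra_simps prod sum
        del: fps_const_mult fps_const_add fps_const_neg)
qed

section \<open>Convergence of the normalised products\<close>

definition tail :: "nat \<Rightarrow> nat \<Rightarrow> 'c fps \<times> 'c fps" where
  "tail n k = scale (inverse \<alpha> ^ k) (C_product n k eigenvector)"

lemma disc_pair_tail [simp]: "disc_pair (tail n k)"
  by (simp add: tail_def)

lemma tail_Suc_diff:
  "tail n (Suc k) - tail n k = scale (inverse \<alpha> ^ Suc k) (C_product n k (0, fps_const e * (Phi p (n + Suc k) - of_nat p)))"
proof -
  \<comment> \<open>Multiplying the eigenvector by \<alpha> compensates the missing scalar, so that
    both terms are images under the same \<open>C_product n k\<close>.\<close>
  have "inverse \<alpha> ^ Suc k * \<alpha> = inverse \<alpha> ^ k" using alpha_nonzero by (simp add: field_simps)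
  then have "tail n k = scale (inverse \<alpha> ^ Suc k) (C_product n k (scale \<alpha> eigenvector))"
    by (simp only: tail_def C_product_scale scale_scale)
  then show ?thesis
    by (simp add: tail_def C_apply_eigenvector flip: scale_diff C_product_diff)
qed

text \<open>The scalar grows like a power of 1/|\<alpha>| = p |\<beta>| while the deviation of the
  cyclotomic polynomial from p decays like a power of 1/p; what remains is a power of
  |\<beta>|.\<close>

lemma pair_norm_tail_Suc_diff:
  assumes "1 \<le> n"
  shows "pair_norm (rad n) (tail n (Suc k) - tail n k) \<le> absp \<beta> ^ Suc k / real p"
proof -
  note r = rad_pos [of n] rad_less_1 [of n]
  let ?d = "(0, fps_const e * (Phi p (n + Suc k) - of_nat p))"
  have d: "disc_pair ?d" by (simp add: disc_pair_def)
  have "pair_norm (rad n) ?d \<le> (1 / real p) ^ (k + 2)"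
    using gauss_norm_Phi_minus_p_le [OF assms, of k] r by (simp add: pair_norm_def gauss_norm_mult absp_e)
  then have "pair_norm (rad n) (C_product n k ?d) \<le> (1 / real p) ^ (k + 2)"
    using pair_norm_C_product_le [OF d r, of n k] by linarith
  then have "pair_norm (rad n) (tail n (Suc k) - tail n k) \<le> inverse (absp \<alpha>) ^ Suc k * (1 / real p) ^ (k + 2)"
    unfolding tail_Suc_diff using r d
    by (simp add: pair_norm_scale v_power v_inverse v_mult mult_left_mono del: power_Suc)
  also have "\<dots> = absp \<beta> ^ Suc k / real p"
    using p_ge_3 beta_nonzero by (simp add: absp_alpha power_mult_distrib power_divide field_simps)
  finally show ?thesis .
qed

lemma tail_0 [simp]: "tail n 0 = eigenvector"
  by (simp add: tail_def scale_def)

text \<open>By the ultrametric inequality the sum of all steps is no larger than the bound on the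
  first one.\<close>

lemma pair_norm_tail_diff_eigenvector:
  assumes "1 \<le> n"
  shows "pair_norm (rad n) (tail n k - eigenvector) \<le> absp \<beta> / real p"
proof (induction k)
  case (Suc k)
  note r = rad_pos [of n] rad_less_1 [of n]
  have "tail n (Suc k) - eigenvector = (tail n (Suc k) - tail n k) - (eigenvector - tail n k)" by simp
  then have "pair_norm (rad n) (tail n (Suc k) - eigenvector)
      \<le> max (pair_norm (rad n) (tail n (Suc k) - tail n k)) (pair_norm (rad n) (eigenvector - tail n k))"
    using pair_norm_diff [OF _ _ r] disc_pair_diff disc_pair_tail disc_pair_eigenvector by metis
  moreover have "pair_norm (rad n) (eigenvector - tail n k) = pair_norm (rad n) (tail n k - eigenvector)"
    using gauss_norm_minus [of "rad n" "fst (tail n k - eigenvector)"] gauss_norm_minus [of "rad n" "snd (tail n k - eigenvector)"]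
    by (simp add: pair_norm_def)
  moreover have "absp \<beta> ^ Suc k / real p \<le> absp \<beta> / real p"
    using absp_beta_less_1 power_decreasing [of 1 "Suc k" "absp \<beta>"] by (intro divide_right_mono) auto
  ultimately show ?case using Suc pair_norm_tail_Suc_diff [OF assms, of k] by linarith
qed (simp add: pair_norm_def)

text \<open>The first column of \<open>Mlog_approx\<close>: the power of the inverse of C acts on
  the eigenvector as a scalar.\<close>

definition log_approx :: "nat \<Rightarrow> 'c fps \<times> 'c fps" where
  "log_approx N = scale (inverse \<alpha> ^ (N + 2)) (C_product 0 N eigenvector)"

lemma disc_pair_log_approx [simp]: "disc_pair (log_approx N)"
  by (simp add: log_approx_def)

text \<open>Splitting at level n separates two regimes at the radius \<open>rad n\<close>: the
  factors beyond n keep the vector close to the eigenvector, the first n factors are a fixed product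
  not depending on k.\<close>

lemma log_approx_eq_tail: "log_approx (n + k) = scale (inverse \<alpha> ^ (n + 2)) (C_product 0 n (tail n k))"
  by (simp add: log_approx_def tail_def C_product_add C_product_scale scale_scale power_add mult_ac)

lemma pair_norm_log_approx_diff:
  assumes "1 \<le> n"
  shows "pair_norm (rad n) (log_approx (n + Suc k) - log_approx (n + k)) \<le> inverse (absp \<alpha>) ^ (n + 2) * absp \<beta> ^ k"
proof -
  note r = rad_pos [of n] rad_less_1 [of n]
  have d: "disc_pair (tail n (Suc k) - tail n k)" by (intro disc_pair_diff) auto
  have "absp \<beta> ^ Suc k / real p \<le> absp \<beta> ^ k"
  proof -
    have "absp \<beta> ^ Suc k / real p \<le> absp \<beta> ^ Suc k" 
      using p_ge_3 divide_left_mono [of 1 "real p" "absp \<beta> ^ Suc k"] by simp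
    also have "\<dots> \<le> absp \<beta> ^ k" using absp_beta_less_1 by (intro power_decreasing) auto
    finally show ?thesis .
  qed
  then have "pair_norm (rad n) (C_product 0 n (tail n (Suc k) - tail n k)) \<le> absp \<beta> ^ k"
    using pair_norm_tail_Suc_diff [OF assms, of k] pair_norm_C_product_le [OF d r, of 0 n] by linarith
  then have "inverse (absp \<alpha>) ^ (n + 2) * pair_norm (rad n) (C_product 0 n (tail n (Suc k) - tail n k))
      \<le> inverse (absp \<alpha>) ^ (n + 2) * absp \<beta> ^ k"
    by (rule mult_left_mono) simp
  moreover have "pair_norm (rad n) (scale (inverse \<alpha> ^ (n + 2)) (C_product 0 n (tail n (Suc k) - tail n k)))
      = inverse (absp \<alpha>) ^ (n + 2) * pair_norm (rad n) (C_product 0 n (tail n (Suc k) - tail n k))"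
    using pair_norm_scale [OF disc_pair_C_product [OF d] r] by (simp only: v_power v_inverse)
  ultimately show ?thesis by (simp only: log_approx_eq_tail scale_diff C_product_diff)
qed

text \<open>Differences telescope, and ultrametrically the first step bounds them all. Completeness
  gives the limit, and the bound passes to it by continuity of the distance.\<close>

lemma geometric_steps_limit:
  fixes s :: "nat \<Rightarrow> 'c"
  assumes step: "\<And>k. absp (s (Suc k) - s k) \<le> K * b ^ k" and b: "0 \<le> b" "b < 1" and K: "0 \<le> K"
  obtains l where "s \<longlonglongrightarrow> l" "\<And>k. absp (l - s k) \<le> K * b ^ k"
proof -
  have tele: "absp (s (k + j) - s k) \<le> K * b ^ k" for k j
  proof (induction j)
    case (Suc j)
    have "K * b ^ (k + j) \<le> K * b ^ k" using b K by (intro mult_left_mono power_decreasing) auto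
    then have "absp (s (Suc (k + j)) - s (k + j)) \<le> K * b ^ k" using step [of "k + j"] by linarith
    moreover have "s (k + Suc j) - s k = (s (Suc (k + j)) - s (k + j)) + (s (k + j) - s k)" by simp
    ultimately show ?case using Suc v_add [of "s (Suc (k + j)) - s (k + j)" "s (k + j) - s k"] by simp
  qed (use b K in simp)
  have lim0: "(\<lambda>k. K * b ^ k) \<longlonglongrightarrow> 0"
    using b by (intro tendsto_mult_right_zero LIMSEQ_power_zero) simp
  have "Cauchy s"
  proof (rule metric_CauchyI)
    fix \<epsilon> :: real assume "0 < \<epsilon>"
    then have "\<forall>\<^sub>F k in sequentially. K * b ^ k < \<epsilon>" using lim0 by (intro order_tendstoD)
    then obtain M where M: "K * b ^ M < \<epsilon>" by (auto simp: eventually_sequentially)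
    have "dist (s m) (s n) < \<epsilon>" if "m \<ge> M" "n \<ge> M" for m n
    proof -
      have "absp (s m - s M) \<le> K * b ^ M" "absp (s n - s M) \<le> K * b ^ M"
        using tele [of M "m - M"] tele [of M "n - M"] that by simp_all
      then have "absp ((s m - s M) - (s n - s M)) \<le> K * b ^ M"
        using v_diff [of "s m - s M" "s n - s M"] by linarith
      then show ?thesis using M by (simp add: dist_eq)
    qed
    then show "\<exists>M. \<forall>m\<ge>M. \<forall>n\<ge>M. dist (s m) (s n) < \<epsilon>" by blast
  qed
  then obtain l where l: "s \<longlonglongrightarrow> l" using Cauchy_convergent_iff convergent_def by blast
  have "absp (l - s k) \<le> K * b ^ k" for k
  proof -
    have "(\<lambda>j. dist (s (j + k)) (s k)) \<longlonglongrightarrow> dist l (s k)"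
      by (intro tendsto_dist tendsto_const LIMSEQ_ignore_initial_segment l)
    then have "dist l (s k) \<le> K * b ^ k"
      using tele [of k] by (intro LIMSEQ_le_const2) (auto simp: dist_eq add.commute)
    then show ?thesis by (simp add: dist_eq)
  qed
  with l show ?thesis by (rule that)
qed

definition log_limit :: "('c fps \<times> 'c fps \<Rightarrow> 'c fps) \<Rightarrow> 'c fps" where
  "log_limit \<pi> = Abs_fps (\<lambda>i. lim (\<lambda>N. fps_nth (\<pi> (log_approx N)) i))"

text \<open>Each coefficient converges geometrically. Weighted by \<open>rad n ^ i\<close>, the
  error bound no longer depends on i and so becomes a bound on a Gauss norm.\<close>

lemma log_limit_coeff:
  assumes \<pi>: "\<pi> = fst \<or> \<pi> = snd" and n: "1 \<le> n"
  shows "absp (fps_nth (log_limit \<pi> - \<pi> (log_approx (n + k))) i) * rad n ^ i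
    \<le> inverse (absp \<alpha>) ^ (n + 2) * absp \<beta> ^ k"
proof -
  note r = rad_pos [of n] rad_less_1 [of n]
  let ?K = "inverse (absp \<alpha>) ^ (n + 2)"
  define s where "s j = fps_nth (\<pi> (log_approx (n + j))) i" for j
  have step: "absp (s (Suc j) - s j) \<le> ?K / rad n ^ i * absp \<beta> ^ j" for j
  proof -
    let ?d = "\<pi> (log_approx (n + Suc j)) - \<pi> (log_approx (n + j))"
    have "disc (\<pi> (log_approx m))" for m using \<pi> disc_pair_log_approx [of m] by (auto simp: disc_pair_def)
    then have "absp (fps_nth ?d i) * rad n ^ i \<le> gauss_norm (rad n) ?d"
      using r by (intro gauss_norm_ge) auto
    also have "\<dots> \<le> ?K * absp \<beta> ^ j"
      using pair_norm_log_approx_diff [OF n, of j] \<pi> by (auto simp: pair_norm_def)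
    finally show ?thesis using r by (simp add: s_def pos_le_divide_eq)
  qed
  have "0 \<le> ?K / rad n ^ i" using r by simp
  then obtain l where l: "s \<longlonglongrightarrow> l" and bound: "\<And>j. absp (l - s j) \<le> ?K / rad n ^ i * absp \<beta> ^ j"
    using geometric_steps_limit [OF step v_nonneg absp_beta_less_1] by blast
  have "s = (\<lambda>j. fps_nth (\<pi> (log_approx (j + n))) i)" by (simp add: s_def fun_eq_iff add.commute)
  with l have "(\<lambda>j. fps_nth (\<pi> (log_approx (j + n))) i) \<longlonglongrightarrow> l" by simp
  then have "(\<lambda>N. fps_nth (\<pi> (log_approx N)) i) \<longlonglongrightarrow> l" by (rule LIMSEQ_offset)
  then have "fps_nth (log_limit \<pi>) i = l" by (simp add: log_limit_def limI)
  then show ?thesis using bound [of k] r by (simp add: s_def pos_le_divide_eq)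
qed

text \<open>Every r < 1 lies below some \<open>rad n\<close>, and on that larger circle the terms of
  the limit differ from those of \<open>log_approx n\<close> by a bounded amount.\<close>

lemma disc_log_limit:
  assumes "\<pi> = fst \<or> \<pi> = snd"
  shows "disc (log_limit \<pi>)"
proof (rule discI)
  fix r :: real assume r: "0 < r" "r < 1"
  have "\<forall>\<^sub>F n in sequentially. r < rad n \<and> 1 \<le> n"
    using rad_tendsto r by (intro eventually_conj order_tendstoD eventually_ge_at_top)
  then obtain n where n: "r < rad n" "1 \<le> n" by (auto dest: eventually_happens)
  let ?K = "inverse (absp \<alpha>) ^ (n + 2)" and ?a = "\<pi> (log_approx n)"
  have disc: "disc ?a" using assms disc_pair_log_approx [of n] by (auto simp: disc_pair_def)
  have "absp (fps_nth (log_limit \<pi>) i) * r ^ i \<le> max ?K (gauss_norm (rad n) ?a)" for i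
  proof -
    have "absp (fps_nth (log_limit \<pi>) i) * r ^ i \<le> absp (fps_nth (log_limit \<pi>) i) * rad n ^ i"
      using r n by (intro mult_left_mono power_mono) auto
    also have "\<dots> \<le> max (absp (fps_nth (log_limit \<pi> - ?a) i)) (absp (fps_nth ?a i)) * rad n ^ i"
      using v_add [of "fps_nth (log_limit \<pi> - ?a) i" "fps_nth ?a i"] rad_pos [of n]
      by (intro mult_right_mono) auto
    also have "\<dots> = max (absp (fps_nth (log_limit \<pi> - ?a) i) * rad n ^ i) (absp (fps_nth ?a i) * rad n ^ i)"
      using rad_pos [of n] by (simp add: max_mult_distrib_right)
    also have "\<dots> \<le> max ?K (gauss_norm (rad n) ?a)"
      using log_limit_coeff [OF assms n(2), of 0 i] gauss_norm_ge [OF disc rad_pos [of n] rad_less_1, of i]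
      by (intro max.mono) auto
    finally show ?thesis .
  qed
  then show "\<exists>B. \<forall>n. absp (fps_nth (log_limit \<pi>) n) * r ^ n \<le> B" by blast
qed

lemma gauss_norm_log_limit_diff:
  assumes "\<pi> = fst \<or> \<pi> = snd" "1 \<le> n"
  shows "gauss_norm (rad n) (log_limit \<pi> - \<pi> (log_approx (n + k))) \<le> inverse (absp \<alpha>) ^ (n + 2) * absp \<beta> ^ k"
  by (rule gauss_norm_le) (rule log_limit_coeff [OF assms])

section \<open>Alternating domination of the two entries\<close>

definition phi_size :: "nat \<Rightarrow> real" where
  "phi_size k = (1 / real p) powr (1 / real p ^ k)"

text \<open>Here \<open>phi_size k\<close> is the norm of \<open>Phi p (n - k)\<close> at
  \<open>rad n\<close> for 0 < k < n, smallest for k = 1. The hypothesis on a_p puts both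
  \<open>ap\<close> and \<beta> strictly below \<open>phi_size 1\<close>, so this is the uniform
  factor of domination.\<close>

definition ratio :: real where
  "ratio = max (absp ap) (absp \<beta>) / phi_size 1"

lemma phi_size_pos: "0 < phi_size k"
  using p_ge_3 by (simp add: phi_size_def)

lemma phi_size_mono: "k \<le> l \<Longrightarrow> phi_size k \<le> phi_size l"
  unfolding phi_size_def using p_ge_3
  by (intro powr_mono') (auto intro!: divide_left_mono power_increasing)

lemma phi_size_less_1: "phi_size k < 1"
  unfolding phi_size_def by (rule powr_less_1)

lemma ratio_pos: "0 < ratio" and ratio_less_1: "ratio < 1"
  using phi_size_pos [of 1] beta_nonzero absp_ap absp_beta_less
  by (auto simp: ratio_def phi_size_def less_max_iff_disj)

lemma absp_ap_le_ratio: "absp ap \<le> ratio * phi_size k" and absp_beta_le_ratio: "absp \<beta> \<le> ratio * phi_size k" if "1 \<le> k"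
proof -
  have "ratio * phi_size 1 \<le> ratio * phi_size k" using that ratio_pos phi_size_mono by (intro mult_left_mono) auto
  moreover have "ratio * phi_size 1 = max (absp ap) (absp \<beta>)" using phi_size_pos [of 1] by (simp add: ratio_def)
  ultimately show "absp ap \<le> ratio * phi_size k" "absp \<beta> \<le> ratio * phi_size k" by linarith+
qed

text \<open>The sizes at radius \<open>rad n\<close> after applying \<open>k\<close> of the matrices \<open>C\<^sub>n\<^sub>-\<^sub>1, C\<^sub>n\<^sub>-\<^sub>2, \<dots>\<close>: the two
  entries take turns in dominating.\<close>

definition alternating :: "real \<Rightarrow> real \<Rightarrow> nat \<Rightarrow> 'c fps \<times> 'c fps \<Rightarrow> bool" where
  "alternating r L k w \<longleftrightarrow>
     (if even k then L \<le> gauss_norm r (fst w) \<and> gauss_norm r (snd w) \<le> ratio * phi_size (Suc k) * gauss_norm r (fst w)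
      else L \<le> gauss_norm r (snd w) \<and> gauss_norm r (fst w) \<le> ratio * gauss_norm r (snd w))"

text \<open>One matrix sends (f, g) to (ap f + g, - e \<Phi> f). If f dominates, the new second
  entry has size \<open>phi_size (Suc k)\<close> times that of f, and the first is smaller by
  \<open>ratio\<close>. If g dominates, the new first entry has the size of g. The lower bound loses
  at most the factor \<open>phi_size 1\<close>.\<close>

lemma alternating_step:
  assumes "disc_pair w" "Suc k < n" "0 \<le> L" "alternating (rad n) L k w"
  shows "alternating (rad n) (phi_size 1 * L) (Suc k) (C_apply (n - Suc k) w)"
proof -
  note r = rad_pos [of n] rad_less_1 [of n]
  define f g f' g' where "f = gauss_norm (rad n) (fst w)" and "g = gauss_norm (rad n) (snd w)"
    and "f' = gauss_norm (rad n) (fst (C_apply (n - Suc k) w))" and "g' = gauss_norm (rad n) (snd (C_apply (n - Suc k) w))"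
  have f: "0 \<le> f" and g: "0 \<le> g" using assms(1) r by (auto simp: f_def g_def disc_pair_def intro: gauss_norm_nonneg)
  have f': "f' \<le> max (absp ap * f) g" unfolding f'_def f_def g_def by (rule gauss_norm_C_apply [OF assms(1) r])
  have "gauss_norm (rad n) (Phi p (n - Suc k)) = phi_size (Suc k)"
    using assms(2) by (simp add: gauss_norm_Phi_eq_powr phi_size_def)
  then have g': "g' = phi_size (Suc k) * f" unfolding g'_def f_def using gauss_norm_C_apply(2) [OF assms(1) r] by simp
  show ?thesis
  proof (cases "even k")
    case True
    then have *: "L \<le> f" "g \<le> ratio * phi_size (Suc k) * f"
      using assms(4) by (auto simp: alternating_def f_def g_def)
    have "phi_size 1 * L \<le> g'"
      unfolding g' using * phi_size_mono [of 1 "Suc k"] phi_size_pos [of "Suc k"] assms(3) by (intro mult_mono) auto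
    moreover have "absp ap * f \<le> ratio * phi_size (Suc k) * f"
      using f absp_ap_le_ratio [of "Suc k"] by (intro mult_right_mono) auto
    then have "f' \<le> ratio * g'" using f' * by (simp add: g' mult.assoc)
    ultimately show ?thesis using True by (simp add: alternating_def f'_def g'_def)
  next
    case False
    then have *: "L \<le> g" "f \<le> ratio * g"
      using assms(4) by (auto simp: alternating_def f_def g_def)
    \<comment> \<open>Unless both entries vanish, \<open>ap\<close> times the first entry is
      strictly smaller than the second, so no cancellation can occur.\<close>
    have eq: "f' = g"
    proof (cases "g = 0")
      case True
      then have "f = 0" using * f by simp
      then show ?thesis using f' True gauss_norm_nonneg [of "fst (C_apply (n - Suc k) w)" "rad n"] r assms(1) disc_pair_C_apply [of w "n - Suc k"]
        by (simp add: f'_def disc_pair_def)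
    next
      case ne: False
      have "absp ap * f \<le> 1 * f" using absp_ap_less_1 f by (intro mult_right_mono) auto
      moreover have "ratio * g < g" using ratio_less_1 g ne by simp
      ultimately have "absp ap * f < g" using * by linarith
      then show ?thesis
        using gauss_norm_add_eq [of "fps_const ap * fst w" "snd w" "rad n"] r assms(1)
        by (simp add: f'_def f_def g_def C_apply_def disc_pair_def gauss_norm_mult)
    qed
    have "phi_size 1 * L \<le> 1 * L" using phi_size_less_1 [of 1] assms(3) by (intro mult_right_mono) auto
    then have "phi_size 1 * L \<le> f'" using eq * by simp
    moreover have "g' \<le> ratio * phi_size (Suc (Suc k)) * f'"
    proof -
      have "phi_size (Suc k) * f \<le> phi_size (Suc (Suc k)) * (ratio * g)"
        using * phi_size_mono [of "Suc k" "Suc (Suc k)"] phi_size_pos [of "Suc (Suc k)"] f by (intro mult_mono) auto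
      then show ?thesis by (simp add: g' eq mult_ac)
    qed
    ultimately show ?thesis using False by (simp add: alternating_def f'_def g'_def)
  qed
qed

text \<open>The counter n - 1 - j records the matrices below level n already applied when j of them
  remain.\<close>

lemma alternating_C_product:
  assumes "disc_pair w" "j < n" "0 \<le> L" "alternating (rad n) L (n - 1 - j) w"
  shows "alternating (rad n) (phi_size 1 ^ j * L) (n - 1) (C_product 0 j w)"
  using assms
proof (induction j arbitrary: w L)
  case (Suc j)
  have k: "Suc (n - 1 - Suc j) = n - 1 - j" "n - (n - 1 - j) = Suc j" using Suc.prems by auto
  have "alternating (rad n) (phi_size 1 * L) (n - 1 - j) (C_apply (Suc j) w)"
    using alternating_step [of w "n - 1 - Suc j" n L] Suc.prems k by simp
  then have "alternating (rad n) (phi_size 1 ^ j * (phi_size 1 * L)) (n - 1) (C_product 0 j (C_apply (Suc j) w))"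
    using Suc.prems phi_size_pos [of 1] by (intro Suc.IH) auto
  then show ?case by (simp add: mult_ac)
qed simp

text \<open>The matrix with index n sends the eigenvector to a vector with first entry -\<alpha>.
  Its second entry carries \<open>Phi p n\<close>, of size at most 1/p on this circle, and replacing
  the eigenvector by the tail changes neither conclusion.\<close>

lemma alternating_start:
  assumes "1 \<le> n"
  shows "alternating (rad n) (absp \<alpha>) 0 (C_apply n (tail n k))"
proof -
  note r = rad_pos [of n] rad_less_1 [of n]
  define d where "d = tail n k - eigenvector"
  have d: "disc_pair d" by (simp add: d_def disc_pair_diff)
  have tail: "tail n k = eigenvector + d" by (simp add: d_def)
  have nd: "pair_norm (rad n) d \<le> absp \<beta> / real p" unfolding d_def by (rule pair_norm_tail_diff_eigenvector [OF assms])
  \<comment> \<open>This is |\<beta>|^2 < 1 in disguise, because |\<alpha>| = 1/(p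
    |\<beta>|).\<close>
  have small: "absp \<beta> / real p < absp \<alpha>"
  proof -
    have "absp \<beta> * absp \<beta> < 1 * 1" using absp_beta_less_1 by (intro mult_strict_mono) auto
    then show ?thesis using beta_nonzero p_ge_3 by (simp add: absp_alpha field_simps)
  qed
  have "fst (C_apply n (tail n k)) = fst (C_apply n d) - fps_const \<alpha>"
  proof -
    have "fps_const ap = fps_const \<alpha> + fps_const \<beta>" by (simp add: roots_sum)
    then show ?thesis
      unfolding tail C_apply_def eigenvector_def by (simp add: algebra_simps del: fps_const_add)
  qed
  moreover have "gauss_norm (rad n) (fst (C_apply n d)) < absp \<alpha>"
    using pair_norm_C_apply_le [OF d r, of n] nd small unfolding pair_norm_def by linarith
  ultimately have 1: "gauss_norm (rad n) (fst (C_apply n (tail n k))) = absp \<alpha>"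
    using gauss_norm_add_eq [of "fst (C_apply n d)" "- fps_const \<alpha>" "rad n"] r d disc_pair_C_apply [of d n]
    by (simp add: disc_pair_def del: fps_const_neg)
  have ft: "gauss_norm (rad n) (fst (tail n k)) \<le> 1"
  proof -
    have "absp \<beta> / real p \<le> 1" using absp_beta_less_1 p_ge_3 by (simp add: divide_simps)
    then show ?thesis
      using gauss_norm_add [of "- 1" "fst d" "rad n"] r d nd gauss_norm_const [of "rad n" 1]
      by (simp add: tail eigenvector_def disc_pair_def pair_norm_def)
  qed
  have "gauss_norm (rad n) (snd (C_apply n (tail n k))) \<le> 1 / real p * 1"
    unfolding gauss_norm_C_apply(2) [OF disc_pair_tail r]
    using ft gauss_norm_Phi_self_le [OF assms] disc_pair_tail [of n k] r
    by (intro mult_mono) (auto simp: disc_pair_def intro: gauss_norm_nonneg)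
  \<comment> \<open>Rewriting 1/p as the size of \<alpha> \<beta> exposes the factor \<beta>, which
    \<open>ratio\<close> controls.\<close>
  also have "\<dots> = absp \<beta> * absp \<alpha>" using absp_roots_mult by (simp add: mult.commute)
  also have "\<dots> \<le> ratio * phi_size 1 * absp \<alpha>" using absp_beta_le_ratio [of 1] by (intro mult_right_mono) auto
  finally show ?thesis using 1 by (simp add: alternating_def)
qed

lemma alternating_scale:
  assumes "disc_pair w" "0 < r" "r < 1" "alternating r L k w"
  shows "alternating r (absp a * L) k (scale a w)"
  using assms
  by (auto simp: alternating_def scale_def disc_pair_def gauss_norm_mult mult.left_commute [of _ "absp a"] intro!: mult_left_mono)

text \<open>The lower bound is the same for all k; this is what lets domination survive the
  limit.\<close>

lemma alternating_log_approx:
  assumes "1 \<le> n"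
  obtains L where "0 < L" "\<And>k. alternating (rad n) L (n - 1) (log_approx (n + k))"
proof
  let ?a = "inverse \<alpha> ^ (n + 2)"
  show "0 < absp ?a * (phi_size 1 ^ (n - 1) * absp \<alpha>)"
    using alpha_nonzero phi_size_pos [of 1] by (intro mult_pos_pos zero_less_power) auto
  show "alternating (rad n) (absp ?a * (phi_size 1 ^ (n - 1) * absp \<alpha>)) (n - 1) (log_approx (n + k))" for k
  proof -
    have "C_product 0 n w = C_product 0 (n - 1) (C_apply n w)" for w
      using assms by (cases n) auto
    then have "log_approx (n + k) = scale ?a (C_product 0 (n - 1) (C_apply n (tail n k)))"
      by (simp only: log_approx_eq_tail)
    moreover have "alternating (rad n) (phi_size 1 ^ (n - 1) * absp \<alpha>) (n - 1) (C_product 0 (n - 1) (C_apply n (tail n k)))"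
      using alternating_start [OF assms] assms by (intro alternating_C_product) auto
    ultimately show ?thesis using alternating_scale rad_pos rad_less_1 by simp
  qed
qed

text \<open>An approximation error below \<open>ratio * L\<close> cannot change the norm of
  \<open>G k\<close>, and in the bound for f it is absorbed. So the limit inherits the same
  ratio.\<close>

lemma gauss_norm_dominates_limit:
  assumes "disc f" "disc g" "\<And>k. disc (F k)" "\<And>k. disc (G k)" "0 < r" "r < 1"
    and F: "\<And>k. gauss_norm r (f - F k) \<le> K * absp \<beta> ^ k" and G: "\<And>k. gauss_norm r (g - G k) \<le> K * absp \<beta> ^ k"
    and dom: "\<And>k. gauss_norm r (F k) \<le> ratio * gauss_norm r (G k)" "\<And>k. L \<le> gauss_norm r (G k)" and L: "0 < L"
  shows "gauss_norm r f \<le> ratio * gauss_norm r g" "g \<noteq> 0"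
proof -
  have "(\<lambda>k. K * absp \<beta> ^ k) \<longlonglongrightarrow> 0"
    using absp_beta_less_1 by (intro tendsto_mult_right_zero LIMSEQ_power_zero) simp
  moreover have rL: "0 < ratio * L" using L ratio_pos by simp
  ultimately have "\<forall>\<^sub>F k in sequentially. K * absp \<beta> ^ k < ratio * L" by (intro order_tendstoD)
  then obtain k where k: "K * absp \<beta> ^ k < ratio * L" by (auto simp: eventually_sequentially)
  have "ratio * L \<le> ratio * gauss_norm r (G k)" using dom(2) ratio_pos by (intro mult_left_mono) auto
  moreover have "ratio * L \<le> 1 * L" using ratio_less_1 L by (intro mult_right_mono) auto
  ultimately have small: "gauss_norm r (f - F k) \<le> ratio * gauss_norm r (G k)" "gauss_norm r (g - G k) < gauss_norm r (G k)"
    using k F [of k] G [of k] dom(2) [of k] by linarith+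
  have eq: "gauss_norm r g = gauss_norm r (G k)"
    using gauss_norm_add_eq [of "g - G k" "G k" r] small assms by simp
  have "gauss_norm r f \<le> max (gauss_norm r (f - F k)) (gauss_norm r (F k))"
    using gauss_norm_add [of "f - F k" "F k" r] assms by simp
  then show "gauss_norm r f \<le> ratio * gauss_norm r g" using eq small dom(1) [of k] by simp
  show "g \<noteq> 0" using eq dom(2) [of k] L by auto
qed

text \<open>After the matrix with index n, exactly n - 1 more are applied, so the parity of n
  decides which entry ends up dominating.\<close>

lemma log_limit_dominates:
  assumes "1 \<le> n"
  shows "even n \<Longrightarrow> gauss_norm (rad n) (log_limit fst) \<le> ratio * gauss_norm (rad n) (log_limit snd) \<and> log_limit snd \<noteq> 0"
    and "odd n \<Longrightarrow> gauss_norm (rad n) (log_limit snd) \<le> ratio * gauss_norm (rad n) (log_limit fst) \<and> log_limit fst \<noteq> 0"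
proof -
  note r = rad_pos [of n] rad_less_1 [of n]
  obtain L where L: "0 < L" "\<And>k. alternating (rad n) L (n - 1) (log_approx (n + k))"
    using alternating_log_approx [OF assms] by blast
  have d: "disc (fst (log_approx m))" "disc (snd (log_approx m))" for m
    using disc_pair_log_approx [of m] by (auto simp: disc_pair_def)
  let ?K = "inverse (absp \<alpha>) ^ (n + 2)"
  have lim: "gauss_norm (rad n) (log_limit fst - fst (log_approx (n + k))) \<le> ?K * absp \<beta> ^ k"
    "gauss_norm (rad n) (log_limit snd - snd (log_approx (n + k))) \<le> ?K * absp \<beta> ^ k" for k
    using assms by (intro gauss_norm_log_limit_diff; simp)+
  have dl: "disc (log_limit fst)" "disc (log_limit snd)" by (simp_all add: disc_log_limit)
  show "gauss_norm (rad n) (log_limit fst) \<le> ratio * gauss_norm (rad n) (log_limit snd) \<and> log_limit snd \<noteq> 0" if "even n"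
  proof -
    have "odd (n - 1)" using that assms by simp
    then have "gauss_norm (rad n) (fst (log_approx (n + k))) \<le> ratio * gauss_norm (rad n) (snd (log_approx (n + k)))"
      "L \<le> gauss_norm (rad n) (snd (log_approx (n + k)))" for k
      using L(2) [of k] by (auto simp: alternating_def)
    then show ?thesis
      using gauss_norm_dominates_limit [where F = "\<lambda>k. fst (log_approx (n + k))" and G = "\<lambda>k. snd (log_approx (n + k))" and K = ?K,
          OF dl(1) dl(2) d(1) d(2) r lim(1) lim(2) _ _ L(1)] by blast
  qed
  show "gauss_norm (rad n) (log_limit snd) \<le> ratio * gauss_norm (rad n) (log_limit fst) \<and> log_limit fst \<noteq> 0" if "odd n"
  proof -
    have ev: "even (n - 1)" using that by simp
    have "gauss_norm (rad n) (snd (log_approx (n + k))) \<le> ratio * gauss_norm (rad n) (fst (log_approx (n + k)))" for k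
    proof -
      \<comment> \<open>For an even number of steps the bound carries a further factor below 1,
        which may be dropped here.\<close>
      have "ratio * phi_size (Suc (n - 1)) * gauss_norm (rad n) (fst (log_approx (n + k))) \<le> ratio * 1 * gauss_norm (rad n) (fst (log_approx (n + k)))"
        using phi_size_less_1 [of "Suc (n - 1)"] ratio_pos d r
        by (intro mult_right_mono mult_left_mono gauss_norm_nonneg) auto
      then show ?thesis using L(2) [of k] ev by (simp add: alternating_def)
    qed
    moreover have "L \<le> gauss_norm (rad n) (fst (log_approx (n + k)))" for k
      using L(2) [of k] ev by (simp add: alternating_def)
    ultimately show ?thesis
      using gauss_norm_dominates_limit [where F = "\<lambda>k. snd (log_approx (n + k))" and G = "\<lambda>k. fst (log_approx (n + k))" and K = ?K,
          OF dl(2) dl(1) d(2) d(1) r lim(2) lim(1) _ _ L(1)] by blast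
  qed
qed

lemma frequently_rad:
  assumes "\<And>n. 1 \<le> n \<Longrightarrow> even n \<longleftrightarrow> parity \<Longrightarrow> P (rad n)"
  shows "\<exists>\<^sub>F r in at_left 1. P r"
  unfolding frequently_at_left_1
proof (intro allI impI)
  fix c :: real assume "c < 1"
  then have "\<forall>\<^sub>F n in sequentially. c < rad n" using rad_tendsto by (intro order_tendstoD)
  then obtain N where N: "\<And>n. n \<ge> N \<Longrightarrow> c < rad n" by (auto simp: eventually_sequentially)
  define n where "n = 2 * N + (if parity then 2 else 1)"
  have "1 \<le> n" "N \<le> n" "even n \<longleftrightarrow> parity" by (auto simp: n_def)
  then show "\<exists>r>c. r < 1 \<and> P r" using N [of n] assms [of n] rad_less_1 [of n] by blast
qed

lemma log_limit_quadratic_relation_trivial: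
  assumes "\<And>n. absp (fps_nth x n) \<le> 1" "\<And>n. absp (fps_nth y n) \<le> 1" "\<And>n. absp (fps_nth z n) \<le> 1"
    and "x * (log_limit fst)\<^sup>2 + y * (log_limit fst * log_limit snd) + z * (log_limit snd)\<^sup>2 = 0"
  shows "x = 0" "y = 0" "z = 0"
proof -
  \<comment> \<open>The radii \<open>rad 1\<close> and \<open>rad 2\<close>, one of each parity,
    already show that neither entry vanishes.\<close>
  have "log_limit fst \<noteq> 0" "log_limit snd \<noteq> 0"
    using log_limit_dominates(2) [of 1] log_limit_dominates(1) [of 2] by auto
  moreover have "\<exists>\<^sub>F r in at_left 1. gauss_norm r (log_limit fst) \<le> ratio * gauss_norm r (log_limit snd)"
    by (rule frequently_rad [where parity = True]) (use log_limit_dominates in blast)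
  moreover have "\<exists>\<^sub>F r in at_left 1. gauss_norm r (log_limit snd) \<le> ratio * gauss_norm r (log_limit fst)"
    by (rule frequently_rad [where parity = False]) (use log_limit_dominates in blast)
  ultimately show "x = 0" "y = 0" "z = 0"
    using quadratic_relation_trivial [OF disc_log_limit disc_log_limit _ _ _ ratio_less_1 assms] ratio_pos by auto
qed

end

section \<open>Identification with the logarithm matrix\<close>

lemma matrix_mult_nth_column: "(A ** B) $ i $ j = (A *v column j B) $ i"
  by (simp add: matrix_matrix_mult_def matrix_vector_mult_def column_def)

lemma vec2_eqI: "v $ 1 = w $ 1 \<Longrightarrow> v $ 2 = w $ 2 \<Longrightarrow> v = (w :: 'a^2)"
  by (simp add: vec_eq_iff forall_2)

lemma vec22_eqI:
  "v $ 1 $ 1 = w $ 1 $ 1 \<Longrightarrow> v $ 1 $ 2 = w $ 1 $ 2 \<Longrightarrow> v $ 2 $ 1 = w $ 2 $ 1 \<Longrightarrow> v $ 2 $ 2 = w $ 2 $ 2 \<Longrightarrow> v = (w :: 'a^2^2)"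
  by (simp add: vec_eq_iff forall_2)

lemma mat2_mult_vector:
  "mat2 a b c d *v vector [x, y] = (vector [a * x + b * y, c * x + d * y] :: 'a::semiring_1^2)"
  by (rule vec2_eqI) (simp_all add: matrix_vector_mult_def sum_2)

lemma mat2_mult: "mat2 a b c d ** mat2 a' b' c' d' =
    mat2 (a * a' + b * c') (a * b' + b * d') (c * a' + d * c') (c * b' + d * d' :: 'a::semiring_1)"
  by (rule vec22_eqI) (simp_all add: matrix_matrix_mult_def sum_2)

lemma mat2_one: "mat2 1 0 0 1 = (mat 1 :: 'a::semiring_1^2^2)"
  by (rule vec22_eqI) (simp_all add: mat_def)

text \<open>The inverse is chosen among the two-sided inverses; exhibiting one gives the choice its
  defining property.\<close>

lemma matrix_inv_mult_left:
  fixes A :: "'a::semiring_1^'n^'n"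
  assumes "A ** B = mat 1" "B ** A = mat 1"
  shows "matrix_inv A ** A = mat 1"
  unfolding matrix_inv_def by (rule someI2 [of _ B]) (use assms in auto)

context padic_roots
begin

definition vec_of_pair :: "'c fps \<times> 'c fps \<Rightarrow> 'c fps^2" where
  "vec_of_pair w = vector [fst w, snd w]"

lemma vec_of_pair_nth [simp]: "vec_of_pair w $ 1 = fst w" "vec_of_pair w $ 2 = snd w"
  by (simp_all add: vec_of_pair_def)

lemma matCn_mult_vec_of_pair: "matCn p ap e m *v vec_of_pair w = vec_of_pair (C_apply m w)"
  by (simp add: matCn_def vec_of_pair_def mat2_mult_vector C_apply_def)

lemma prodC_mult_vec_of_pair: "prodC p ap e N *v vec_of_pair w = vec_of_pair (C_product 0 N w)"
  by (induction N arbitrary: w) (simp_all add: matCn_mult_vec_of_pair flip: matrix_vector_mul_assoc)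

lemma matC_mult_eigenvector: "matC p ap e *v vec_of_pair (scale a eigenvector) = vec_of_pair (scale (\<alpha> * a) eigenvector)"
proof -
  have sum: "fps_const ap = fps_const \<alpha> + fps_const \<beta>" by (simp add: roots_sum)
  have prod: "fps_const (- e * of_nat p) = - (fps_const \<alpha> * fps_const \<beta>)" by (simp add: roots_prod)
  show ?thesis
    unfolding matC_def vec_of_pair_def mat2_mult_vector sum prod
    by (simp add: scale_def eigenvector_def algebra_simps flip: fps_const_mult del: fps_const_add fps_const_neg)
qed

lemma matC_inverse: "matrix_inv (matC p ap e) ** matC p ap e = mat 1"
proof -
  obtain d where d: "\<alpha> * \<beta> * d = 1"
    using alpha_nonzero beta_nonzero right_inverse [of "\<alpha> * \<beta>"] by auto
  \<comment> \<open>The adjugate of C divided by its determinant \<alpha> \<beta>.\<close>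
  let ?B = "mat2 0 (- fps_const d) 1 (fps_const ap * fps_const d)"
  have C: "matC p ap e = mat2 (fps_const ap) 1 (- fps_const (\<alpha> * \<beta>)) 0"
    by (simp add: matC_def roots_prod)
  have 1: "fps_const (\<alpha> * \<beta>) * fps_const d = 1" "fps_const d * fps_const (\<alpha> * \<beta>) = 1"
    using d by (simp_all add: mult.commute)
  have "matC p ap e ** ?B = mat 1" "?B ** matC p ap e = mat 1"
    unfolding C mat2_mult mat2_one [symmetric]
    by (simp_all add: 1 mult.assoc del: fps_const_mult fps_const_neg)
  then show ?thesis by (rule matrix_inv_mult_left)
qed

lemma matC_inverse_mult_eigenvector: "matrix_inv (matC p ap e) *v vec_of_pair (scale a eigenvector) = vec_of_pair (scale (inverse \<alpha> * a) eigenvector)"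
proof -
  have "vec_of_pair (scale a eigenvector) = matC p ap e *v vec_of_pair (scale (inverse \<alpha> * a) eigenvector)"
    using alpha_nonzero by (simp add: matC_mult_eigenvector flip: mult.assoc)
  then show ?thesis by (simp add: matrix_vector_mul_assoc matC_inverse)
qed

lemma mat_pow_inverse_mult_eigenvector:
  "mat_pow (matrix_inv (matC p ap e)) k *v vec_of_pair eigenvector = vec_of_pair (scale (inverse \<alpha> ^ k) eigenvector)"
proof (induction k)
  case 0
  then show ?case by (simp add: mat_pow_def scale_def)
next
  case (Suc k)
  have "mat_pow (matrix_inv (matC p ap e)) (Suc k) = matrix_inv (matC p ap e) ** mat_pow (matrix_inv (matC p ap e)) k"
    by (simp add: mat_pow_def)
  then show ?case by (simp add: Suc matC_inverse_mult_eigenvector flip: matrix_vector_mul_assoc)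
qed

text \<open>The first column of a product is the product applied to the first column of the last
  factor, here the eigenvector.\<close>

lemma Mlog_approx_column: "column 1 (Mlog_approx p ap e \<alpha> \<beta> N) = vec_of_pair (log_approx N)"
proof -
  have A: "column 1 (matA \<alpha> \<beta>) = vec_of_pair eigenvector"
    by (rule vec2_eqI) (simp_all add: column_def matA_def eigenvector_def)
  have "column 1 (Mlog_approx p ap e \<alpha> \<beta> N)
      = prodC p ap e N *v (mat_pow (matrix_inv (matC p ap e)) (N + 2) *v vec_of_pair eigenvector)"
    unfolding Mlog_approx_def
    by (simp add: vec_eq_iff column_def [of _ "_ ** _"] matrix_mult_nth_column A matrix_vector_mul_assoc)
  then show ?thesis
    by (simp only: mat_pow_inverse_mult_eigenvector prodC_mult_vec_of_pair C_product_scale log_approx_def)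
qed

lemma Mlog_column: "Mlog p ap e \<alpha> \<beta> $ 1 $ 1 = log_limit fst" "Mlog p ap e \<alpha> \<beta> $ 2 $ 1 = log_limit snd"
proof -
  have "Mlog_approx p ap e \<alpha> \<beta> N $ i $ 1 = vec_of_pair (log_approx N) $ i" for N i
    by (simp add: column_def flip: Mlog_approx_column)
  then show "Mlog p ap e \<alpha> \<beta> $ 1 $ 1 = log_limit fst" "Mlog p ap e \<alpha> \<beta> $ 2 $ 1 = log_limit snd"
    by (simp_all add: Mlog_def log_limit_def)
qed

end

section \<open>From the arithmetic hypotheses to the p-adic estimates\<close>

lemma dirichlet_character_root_of_unity:
  assumes "dirichlet_character N \<epsilon>" "1 \<le> N" "coprime n N"
  shows "\<epsilon> (int n) ^ totient N = 1"
proof -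
  have mult: "\<epsilon> (k * l) = \<epsilon> k * \<epsilon> l" and period: "\<epsilon> (k + int N) = \<epsilon> k"
    and zero: "\<epsilon> k = 0 \<longleftrightarrow> \<not> coprime k (int N)" for k l
    using assms(1) by (simp_all add: dirichlet_character_def)
  have one: "\<epsilon> 1 = 1" using mult [of 1 1] zero [of 1] by simp
  have pow: "\<epsilon> k ^ t = \<epsilon> (k ^ t)" for k t by (induction t) (simp_all add: one mult)
  have shift: "\<epsilon> (k + int j * int N) = \<epsilon> k" for k j
  proof (induction j)
    case (Suc j)
    have "\<epsilon> (k + int (Suc j) * int N) = \<epsilon> (k + int j * int N + int N)" by (simp add: algebra_simps)
    then show ?case by (simp only: period Suc)
  qed simp
  have "\<epsilon> (int (n ^ totient N)) = \<epsilon> 1"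
  proof (cases "n ^ totient N = 0")
    \<comment> \<open>A zero power forces n = 0, hence N = 1 by coprimality, and then periodicity
      identifies the values at 0 and 1.\<close>
    case True
    then have "N = 1" using assms(3) by simp
    then show ?thesis using period [of 0] True by simp
  next
    case False
    have "[n ^ totient N = 1] (mod N)" using assms(3) by (rule euler_theorem)
    then have "N dvd n ^ totient N - 1" using False by (simp add: cong_altdef_nat)
    then obtain j where "n ^ totient N - 1 = N * j" by (elim dvdE)
    then have "n ^ totient N = 1 + j * N" using False mult.commute [of N j] by linarith
    then have "int (n ^ totient N) = 1 + int j * int N" by simp
    then show ?thesis using shift [of 1 j] by metis
  qed
  then show ?thesis by (simp add: pow one)
qed

text \<open>The map is multiplicative only on algebraic numbers, so the powers of x are first
  recognised as roots of T^n - 1.\<close>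

lemma embedding_Qbar_root_of_unity:
  assumes "embedding_Qbar \<iota>" "x ^ n = 1" "0 < n"
  shows "\<iota> x ^ n = 1"
proof -
  have alg: "algebraic (x ^ k)" for k
  proof (rule algebraicI [of "Polynomial.monom 1 n - 1"])
    show "Polynomial.coeff (Polynomial.monom 1 n - 1 :: complex poly) i \<in> \<int>" for i by simp
    have "Polynomial.coeff (Polynomial.monom 1 n - 1 :: complex poly) n = 1" using assms(3) by simp
    then show "Polynomial.monom 1 n - 1 \<noteq> (0 :: complex poly)" by (metis Polynomial.coeff_0 zero_neq_one)
    have "(x ^ k) ^ n = 1" by (metis assms(2) power_commutes power_mult mult.commute power_one)
    then show "poly (Polynomial.monom 1 n - 1) (x ^ k) = 0" by (simp add: poly_monom)
  qed
  have "\<iota> (x ^ k) = \<iota> x ^ k" for k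
  proof (induction k)
    case (Suc k)
    then show ?case using assms(1) alg [of k] alg [of 1] by (simp add: embedding_Qbar_def)
  qed (use assms(1) in \<open>simp add: embedding_Qbar_def\<close>)
  then show ?thesis using assms by (metis embedding_Qbar_def)
qed

lemma absp_less_powr_if_vp_greater:
  assumes "1 < p" "vp p x > ereal y"
  shows "absp x < (1 / real p) powr y"
proof (cases "x = 0")
  case True
  then show ?thesis using assms(1) by (simp add: absp_def)
next
  case False
  then have "log (real p) (absp x) < - y" "0 < absp x" using assms(2) by (auto simp: vp_def absp_def)
  then have "absp x < real p powr (- y)" using assms(1) by (simp add: log_less_iff)
  then show ?thesis using assms(1) by (simp add: powr_divide powr_minus_divide)
qed

text \<open>A root of unity has absolute value 1, which settles \<epsilon>(p); comparing
  coefficients of the factored polynomial gives the sum and product of the roots.\<close>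

lemma padic_roots_hecke_polynomial:
  fixes \<iota> :: "complex \<Rightarrow> 'c::{alg_closed_field,field_char_0,complete_space}"
  assumes p: "Factorial_Ring.prime p" "odd p" and N: "1 \<le> N" "\<not> p dvd N"
    and \<epsilon>: "dirichlet_character N \<epsilon>"
    and padic: "padic_complex_numbers p TYPE('c)" and \<iota>: "embedding_Qbar \<iota>"
    and poly: "[:\<iota> (\<epsilon> (int p)) * of_nat p, - \<iota> (a p), 1:] = [:- \<alpha>, 1:] * [:- \<beta>, 1:]"
    and vp: "vp p (\<iota> (a p)) > ereal (1 / real p)"
  shows "padic_roots p (\<iota> (a p)) (\<iota> (\<epsilon> (int p))) \<alpha> \<beta>"
proof -
  have padicD: "\<And>x y :: 'c. dist x y = absp (x - y)" "\<And>x y :: 'c. absp (x * y) = absp x * absp y"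
    "\<And>x y :: 'c. absp (x + y) \<le> max (absp x) (absp y)" "absp (of_nat p :: 'c) = 1 / real p"
    using padic by (simp_all add: padic_complex_numbers_def)
  interpret nonarch_abs "absp :: 'c \<Rightarrow> real"
    by unfold_locales (use padicD in \<open>auto simp: absp_def\<close>)
  have t: "0 < totient N" using N(1) by simp
  have "coprime p N" using p(1) N(2) by (rule prime_imp_coprime)
  then have "\<epsilon> (int p) ^ totient N = 1" by (rule dirichlet_character_root_of_unity [OF \<epsilon> N(1)])
  then have "\<iota> (\<epsilon> (int p)) ^ totient N = 1" using t by (rule embedding_Qbar_root_of_unity [OF \<iota>])
  then have "absp (\<iota> (\<epsilon> (int p))) ^ totient N = 1 ^ totient N" by (simp flip: v_power)
  then have "absp (\<iota> (\<epsilon> (int p))) = 1" using t by (simp add: power_eq_iff_eq_base del: power_one)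
  moreover have "\<alpha> + \<beta> = \<iota> (a p)" "\<alpha> * \<beta> = \<iota> (\<epsilon> (int p)) * of_nat p"
    using poly by (simp_all add: algebra_simps eq_neg_iff_add_eq_0)
  moreover have "absp (\<iota> (a p)) < (1 / real p) powr (1 / real p)"
    using absp_less_powr_if_vp_greater [OF prime_gt_1_nat [OF p(1)] vp] .
  ultimately show ?thesis using p padicD by unfold_locales auto
qed

section \<open>Integrality under products and specialisation\<close>

context nonarch_abs
begin

lemma v_mult_coeff_le_1:
  assumes "\<And>n. v (fps_nth f n) \<le> 1" "\<And>n. v (fps_nth g n) \<le> 1"
  shows "v (fps_nth (f * g) n) \<le> 1"
  unfolding fps_mult_nth using assms by (intro v_sum_le) (auto simp: v_mult intro: mult_le_one)

lemma v_cyc_coeff_le_1: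
  assumes "\<And>i j. v (fps_nth (fps_nth A i) j) \<le> 1"
  shows "v (fps_nth (cyc A) n) \<le> 1"
  unfolding cyc_def using assms by (auto intro!: v_sum_le)

lemma v_add_le_1: "v a \<le> 1 \<Longrightarrow> v b \<le> 1 \<Longrightarrow> v (a + b) \<le> 1"
  and v_diff_le_1: "v a \<le> 1 \<Longrightarrow> v b \<le> 1 \<Longrightarrow> v (a - b) \<le> 1"
  using v_add [of a b] v_diff [of a b] by auto

end

theorem theoremB:
  fixes p N :: nat
    and \<epsilon> :: "int \<Rightarrow> complex" and a :: "nat \<Rightarrow> complex"
    and \<iota> :: "complex \<Rightarrow> 'c::{alg_closed_field,field_char_0,complete_space}"
    and F :: "'c set" and \<alpha> \<beta> :: 'c
    and K \<pp> \<qq> Qcyc Kinf K\<^sub>p K\<^sub>q :: "complex set"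
    and \<gamma> \<gamma>\<^sub>p \<gamma>\<^sub>q :: "complex \<Rightarrow> complex"
    and \<Omega> \<Omega>' \<Omega>\<^sub>K :: complex
    and L_\<alpha> L_\<beta> L_sharp L_flat LK_\<alpha> LK_\<beta> LK_sharp LK_flat :: "'c fps"
    and LL_\<alpha>\<alpha> LL_\<alpha>\<beta> LL_\<beta>\<alpha> LL_\<beta>\<beta> LL_sharp_sharp LL_sharp_flat LL_flat_sharp LL_flat_flat :: "'c fps fps"
    and M :: "('c fps)^2^2"
  assumes "prime p" and "odd p" and "N \<ge> 1" and "\<not> p dvd N"
    and "dirichlet_character N \<epsilon>" and "normalized_eigenform_weight2 N \<epsilon> a"
    and "padic_complex_numbers p TYPE('c)" and "embedding_Qbar \<iota>"
    and "finite_extension_Qp F" and "\<forall>n. \<iota> (a n) \<in> F"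
    and "\<alpha> \<in> F" and "\<beta> \<in> F"
    and "[:\<iota> (\<epsilon> (int p)) * of_nat p, - \<iota> (a p), 1:] = [:- \<alpha>, 1:] * [:- \<beta>, 1:]"
    and "vp p (\<iota> (a p)) > ereal (1 / real p)"
    and "cyclotomic_Zp_extension p Qcyc" and "topologically_generates \<rat> Qcyc {\<gamma>}"
    and "imaginary_quadratic K" and "splits_as p K \<pp> \<qq>"
    and "Zp_extension p 2 K Kinf"
    and "Zp_extension p 1 K K\<^sub>p" and "unramified_at K K\<^sub>p \<qq>"
    and "Zp_extension p 1 K K\<^sub>q" and "unramified_at K K\<^sub>q \<pp>"
    and "topologically_generates K Kinf {\<gamma>\<^sub>p, \<gamma>\<^sub>q}"
    and "\<forall>x\<in>K\<^sub>q. \<gamma>\<^sub>p x = x" and "\<forall>x\<in>K\<^sub>p. \<gamma>\<^sub>q x = x"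
    and "\<forall>x\<in>Qcyc. \<gamma>\<^sub>p x = \<gamma> x" and "\<forall>x\<in>Qcyc. \<gamma>\<^sub>q x = \<gamma> x"
    and "\<Omega> \<noteq> 0" and "\<Omega>' \<noteq> 0" and "\<Omega>\<^sub>K \<noteq> 0"
    and "padic_L1 p \<iota> F Qcyc \<gamma> a \<epsilon> \<Omega> \<alpha> L_\<alpha>"
    and "padic_L1 p \<iota> F Qcyc \<gamma> a \<epsilon> \<Omega> \<beta> L_\<beta>"
    and "padic_L1 p \<iota> F Qcyc \<gamma> (twist_coeffs K a) (twist_nebentype K \<epsilon>) \<Omega>' \<alpha> LK_\<alpha>"
    and "padic_L1 p \<iota> F Qcyc \<gamma> (twist_coeffs K a) (twist_nebentype K \<epsilon>) \<Omega>' \<beta> LK_\<beta>"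
    and "padic_L2 p \<iota> F K \<pp> Kinf \<gamma>\<^sub>p \<gamma>\<^sub>q a \<epsilon> \<Omega>\<^sub>K \<alpha> \<alpha> LL_\<alpha>\<alpha>"
    and "padic_L2 p \<iota> F K \<pp> Kinf \<gamma>\<^sub>p \<gamma>\<^sub>q a \<epsilon> \<Omega>\<^sub>K \<alpha> \<beta> LL_\<alpha>\<beta>"
    and "padic_L2 p \<iota> F K \<pp> Kinf \<gamma>\<^sub>p \<gamma>\<^sub>q a \<epsilon> \<Omega>\<^sub>K \<beta> \<alpha> LL_\<beta>\<alpha>"
    and "padic_L2 p \<iota> F K \<pp> Kinf \<gamma>\<^sub>p \<gamma>\<^sub>q a \<epsilon> \<Omega>\<^sub>K \<beta> \<beta> LL_\<beta>\<beta>"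
    and "coeffs_in (valuation_ring F) L_sharp" and "coeffs_in (valuation_ring F) L_flat" and "coeffs_in (valuation_ring F) LK_sharp" and "coeffs_in (valuation_ring F) LK_flat"
    and "coeffs_in2 (valuation_ring F) LL_sharp_sharp" and "coeffs_in2 (valuation_ring F) LL_sharp_flat" and "coeffs_in2 (valuation_ring F) LL_flat_sharp" and "coeffs_in2 (valuation_ring F) LL_flat_flat"
    and "M = Mlog p (\<iota> (a p)) (\<iota> (\<epsilon> (int p))) \<alpha> \<beta>"
    and "(vector [L_\<alpha>, L_\<beta>] :: 'c fps^2) = vector [L_sharp, L_flat] v* M"
    and "(vector [LK_\<alpha>, LK_\<beta>] :: 'c fps^2) = vector [LK_sharp, LK_flat] v* M"
    and "mat2 LL_\<alpha>\<alpha> LL_\<alpha>\<beta> LL_\<beta>\<alpha> LL_\<beta>\<beta> =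
           transpose (map_matrix in_p_variable M) ** mat2 LL_sharp_sharp LL_sharp_flat LL_flat_sharp LL_flat_flat ** map_matrix in_q_variable M"
    and "cyc LL_\<alpha>\<alpha> = L_\<alpha> * LK_\<alpha>" and "cyc LL_\<beta>\<beta> = L_\<beta> * LK_\<beta>"
  shows "cyc LL_\<alpha>\<beta> + cyc LL_\<beta>\<alpha> = L_\<alpha> * LK_\<beta> + L_\<beta> * LK_\<alpha> \<and>
         cyc LL_sharp_flat + cyc LL_flat_sharp = L_sharp * LK_flat + L_flat * LK_sharp"
proof -
  let ?m1 = "M $ 1 $ 1" and ?m2 = "M $ 2 $ 1" and ?n1 = "M $ 1 $ 2" and ?n2 = "M $ 2 $ 2"
  interpret padic_roots p "\<iota> (a p)" "\<iota> (\<epsilon> (int p))" \<alpha> \<beta>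
    by (rule padic_roots_hecke_polynomial) (use assms in blast)+
  \<comment> \<open>The first column of \<open>M\<close> governs the \<alpha>\<alpha> entry; its
    entries are the limits compared above.\<close>
  have M: "?m1 = log_limit fst" "?m2 = log_limit snd"
    using assms(48) Mlog_column by simp_all
  have one_var: "L_\<alpha> = L_sharp * ?m1 + L_flat * ?m2" "L_\<beta> = L_sharp * ?n1 + L_flat * ?n2"
    "LK_\<alpha> = LK_sharp * ?m1 + LK_flat * ?m2" "LK_\<beta> = LK_sharp * ?n1 + LK_flat * ?n2"
    using assms(49,50) by (simp_all only: vector2_eq_iff vector2_mult_matrix_nth)
  define S1 S2 S3 S4 where "S1 = cyc LL_sharp_sharp" and "S2 = cyc LL_sharp_flat"
    and "S3 = cyc LL_flat_sharp" and "S4 = cyc LL_flat_flat"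
  have two_var: "cyc (mat2 LL_\<alpha>\<alpha> LL_\<alpha>\<beta> LL_\<beta>\<alpha> LL_\<beta>\<beta> $ i $ j) =
      M $ 1 $ i * S1 * M $ 1 $ j + M $ 2 $ i * S3 * M $ 1 $ j +
      (M $ 1 $ i * S2 * M $ 2 $ j + M $ 2 $ i * S4 * M $ 2 $ j)" for i j
    unfolding assms(51) cyc_factorisation_nth S1_def S2_def S3_def S4_def ..
  define x y z where "x = S1 - L_sharp * LK_sharp"
    and "y = S2 + S3 - (L_sharp * LK_flat + L_flat * LK_sharp)"
    and "z = S4 - L_flat * LK_flat"
  have bounded: "absp (fps_nth L_sharp n) \<le> 1" "absp (fps_nth L_flat n) \<le> 1"
    "absp (fps_nth LK_sharp n) \<le> 1" "absp (fps_nth LK_flat n) \<le> 1"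
    "absp (fps_nth S1 n) \<le> 1" "absp (fps_nth S2 n) \<le> 1"
    "absp (fps_nth S3 n) \<le> 1" "absp (fps_nth S4 n) \<le> 1" for n
    unfolding S1_def S2_def S3_def S4_def using assms(40-47)
    by (auto simp: coeffs_in_def coeffs_in2_def valuation_ring_def intro!: v_cyc_coeff_le_1)
  have xyz: "absp (fps_nth x n) \<le> 1" "absp (fps_nth y n) \<le> 1" "absp (fps_nth z n) \<le> 1" for n
    unfolding x_def y_def z_def fps_sub_nth fps_add_nth
    by (intro v_diff_le_1 v_add_le_1 v_mult_coeff_le_1 bounded)+
  \<comment> \<open>The period normalisation of the \<alpha>\<alpha> entry equates two quadratic
    forms in the first column of \<open>M\<close>, both with integral coefficients.\<close>
  have "?m1 * S1 * ?m1 + ?m2 * S3 * ?m1 + (?m1 * S2 * ?m2 + ?m2 * S4 * ?m2) =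
      (L_sharp * ?m1 + L_flat * ?m2) * (LK_sharp * ?m1 + LK_flat * ?m2)"
    using two_var [of 1 1] assms(52) one_var by simp
  then have "x * ?m1\<^sup>2 + y * (?m1 * ?m2) + z * ?m2\<^sup>2 = 0"
    unfolding x_def y_def z_def by (simp add: algebra_simps power2_eq_square)
  then have "x = 0" "y = 0" "z = 0"
    unfolding M by (rule log_limit_quadratic_relation_trivial [OF xyz])+
  then have S: "S1 = L_sharp * LK_sharp" "S2 + S3 = L_sharp * LK_flat + L_flat * LK_sharp" "S4 = L_flat * LK_flat"
    by (simp_all add: x_def y_def z_def)
  then have S3: "S3 = L_sharp * LK_flat + L_flat * LK_sharp - S2" by (simp add: algebra_simps)
  \<comment> \<open>In this sum \<open>S2\<close> and \<open>S3\<close> have the same coefficient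
    \<open>?m1 * ?n2 + ?n1 * ?m2\<close>, so knowing \<open>S2 + S3\<close> suffices; eliminating
    \<open>S3\<close> leaves a polynomial identity.\<close>
  have "cyc LL_\<alpha>\<beta> + cyc LL_\<beta>\<alpha> = L_\<alpha> * LK_\<beta> + L_\<beta> * LK_\<alpha>"
    unfolding two_var [of 1 2, unfolded mat2_nth] two_var [of 2 1, unfolded mat2_nth] S(1,3) S3 one_var
    by (simp add: algebra_simps)
  then show ?thesis using S(2) by (simp add: S2_def S3_def)
qed

end
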